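(* Let $A$ be an $n\times n$ M-matrix with singular classes $S_1,\dots,S_m$, and let $\mu_i=\max(S_i)$ for $i\in\langle m\rangle$. Let $$\chi=\{(j,j) : j\in\langle n\rangle\setminus\{\mu_i : i\in\langle m\rangle\}\}$$ $$\cup\ \{(j,\mu_i) : i\in\langle m\rangle,\ j>\mu_i \text{ and } j \text{ has access to } \mu_i \text{ in } \mathcal{G}(A)\}$$ $$\cup\ \{(\mu_i,j) : i\in\langle m\rangle,\ j>\mu_i \text{ and } j \text{ is accessed by } \mu_i \text{ in } \mathcal{G}(A)\}.$$ Then $A$ admits a factorization $A=LBU$ where $L$ is a nonsingular lower triangular M-matrix, $U$ is a nonsingular upper triangular M-matrix, and $B=[b_{jk}]$ is an M-matrix such that $b_{jk}=0$ whenever $(j,k)\notin\chi$. Moreover, if $L$ and $U$ are nonsingular M-matrices, this is the finest block structure that $B$ can have (i.e. it is impossible to subdivide the blocks of $B$ and obtain a block diagonal matrix).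
   Context: All matrices are real $n\times n$, and $\langle k\rangle=\{1,\dots,k\}$ for a positive integer $k$. An M-matrix is a matrix of the form $\alpha I-P$ with $P$ entrywise nonnegative and $\alpha\in\mathbb{R}$ greater than or equal to the spectral radius of $P$ (so an M-matrix may be singular). The directed graph $\mathcal{G}(X)$ of $X=[x_{ij}]$ has vertex set $\langle n\rangle$ and edge set $\{(i,j): x_{ij}\neq 0\}$. A vertex $j$ has access to $k$ (equivalently, $k$ is accessed by $j$) if there is a directed path from $j$ to $k$; the empty path is allowed, so every vertex has access to itself. The classes of $X$ are the equivalence classes of the relation "$j$ has access to $k$ and $k$ has access to $j$" in $\mathcal{G}(X)$. A class $J$ of $X$ is a singular class of $X$ if the principal submatrix $X_{JJ}$ (rows and columns indexed by $J$) is singular. The singular classes $S_1,\dots,S_m$ of $A$ are ordered so that $\max(S_i)<\max(S_{i+1})$. Block structures are taken without permutation and with square diagonal blocks, i.e. with respect to partitions of $\langle n\rangle$ into consecutive intervals listed in increasing order; one such partition is finer than another if each of its sets is contained in a set of the other. A matrix is block diagonal with respect to such a partition if all its entries outside the diagonal blocks are zero. *)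

theory Defs
  imports
    "HOL-Library.Disjoint_Sets"
    "Jordan_Normal_Form.Spectral_Radius"
    "Jordan_Normal_Form.DL_Submatrix"
begin

(* Rows and columns of matrices are numbered from 0, so the vertex set <n> = {1,...,n}
   becomes {0..<n}; all notions below depend only on the order of the indices. *)

definition m_matrix :: "real mat \<Rightarrow> bool" where
  "m_matrix A \<longleftrightarrow> (\<exists>n \<alpha> P. P \<in> carrier_mat n n \<and> (\<forall>i<n. \<forall>j<n. 0 \<le> P $$ (i, j)) \<and>
     spectral_radius (map_mat complex_of_real P) \<le> \<alpha> \<and> A = \<alpha> \<cdot>\<^sub>m 1\<^sub>m n - P)"

definition lower_triangular :: "'a::zero mat \<Rightarrow> bool" where
  "lower_triangular A \<longleftrightarrow> (\<forall>i<dim_row A. \<forall>j<dim_col A. i < j \<longrightarrow> A $$ (i, j) = 0)"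

definition graph_of_mat :: "'a::zero mat \<Rightarrow> nat rel" where
  "graph_of_mat A = {(i, j). i < dim_row A \<and> j < dim_col A \<and> A $$ (i, j) \<noteq> 0}"

definition has_access :: "'a::zero mat \<Rightarrow> nat \<Rightarrow> nat \<Rightarrow> bool" where
  "has_access A j k \<longleftrightarrow> j < dim_row A \<and> k < dim_row A \<and> (j, k) \<in> (graph_of_mat A)\<^sup>*"

definition mat_classes :: "'a::zero mat \<Rightarrow> nat set set" where
  "mat_classes A = {0..<dim_row A} // {(j, k). has_access A j k \<and> has_access A k j}"

definition singular_classes :: "real mat \<Rightarrow> nat set set" where
  "singular_classes A = {S \<in> mat_classes A. \<not> invertible_mat (submatrix A S S)}"

(* The set of all mu_i; classes are disjoint, so the mu_i are distinct
   and their numbering is immaterial. *)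
definition singular_maxima :: "real mat \<Rightarrow> nat set" where
  "singular_maxima A = Max ` singular_classes A"

definition chi :: "real mat \<Rightarrow> nat rel" where
  "chi A =
     {(j, j) | j. j \<in> {0..<dim_row A} - singular_maxima A} \<union>
     {(j, \<mu>) | j \<mu>. \<mu> \<in> singular_maxima A \<and> \<mu> < j \<and> has_access A j \<mu>} \<union>
     {(\<mu>, j) | \<mu> j. \<mu> \<in> singular_maxima A \<and> \<mu> < j \<and> has_access A \<mu> j}"

definition interval_partition :: "nat \<Rightarrow> nat set set \<Rightarrow> bool" where
  "interval_partition n P \<longleftrightarrow> partition_on {0..<n} P \<and> (\<forall>J\<in>P. \<exists>a b. J = {a..<b})"

definition within_blocks :: "nat rel \<Rightarrow> nat set set \<Rightarrow> bool" where
  "within_blocks C P \<longleftrightarrow> C \<subseteq> (\<Union>J\<in>P. J \<times> J)"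

definition block_diagonal :: "nat set set \<Rightarrow> 'a::zero mat \<Rightarrow> bool" where
  "block_diagonal P X \<longleftrightarrow> within_blocks (graph_of_mat X) P"

(* The block structure of a zero pattern C (entries outside C vanish): the least
   interval partition, with respect to refinement, with C inside its diagonal blocks. *)
definition block_structure :: "nat \<Rightarrow> nat rel \<Rightarrow> nat set set \<Rightarrow> bool" where
  "block_structure n C P \<longleftrightarrow> interval_partition n P \<and> within_blocks C P \<and>
     (\<forall>Q. interval_partition n Q \<and> within_blocks C Q \<longrightarrow> refines {0..<n} P Q)"

end

theory Submission
  imports Defs
begin

text \<open>The argument is carried by real functions of two indices, restricted to a finite index set, so that
principal submatrices and eliminations are obtained by changing the index set only. The spectral
radius enters through one equivalence (\<open>m_matrix_iff_m_matrix_on\<close>): a matrix is an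
M-matrix iff its off-diagonal entries are nonpositive and no nonzero vector \<open>z \<ge> 0\<close>
satisfies \<open>A z \<le> - \<delta> z\<close> with \<open>\<delta> > 0\<close>.

\<^emph>\<open>Existence.\<close> Induct on the index set by removing its smallest index \<open>p\<close>. If
\<open>a p p > 0\<close>, one step of Gaussian elimination splits off the diagonal entry; the Schur complement
is again an M-matrix, with the same access relation between the remaining indices and the same maxima
of singular classes. If \<open>a p p = 0\<close>, then \<open>{p}\<close> is a class on its own, and it is singular.
With \<open>A' = L' B' U'\<close> for the remaining indices, row and column \<open>p\<close> of the middle factor are
obtained from those of \<open>A\<close> by solving with the triangular factors, which keeps signs
and respects access. Since no index other than \<open>p\<close> both accesses \<open>p\<close> and is accessed by it, the middle
factor is block triangular in a suitable order and hence an M-matrix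
(\<open>m_matrix_on_block_triangular\<close>). The result is \<open>triangular_factorization_on\<close>.

\<^emph>\<open>Minimality.\<close> Let \<open>A = L B U\<close> with \<open>B\<close> block diagonal, let \<open>t\<close> be the first index
after some block, and let \<open>G \<ge> 0\<close> be the inverse of \<open>L\<close>. Then \<open>G A = B U\<close> vanishes in rows from
\<open>t\<close> on and columns before \<open>t\<close>. Let \<open>S\<close> be a singular class that lies before \<open>t\<close>. Multiplication by the positive null
vector of \<open>A\<^bsub>SS\<^esub>\<close>, which exists by \<open>singular_irreducible_null_vector\<close>, shows that every row
\<open>j \<ge> t\<close> of \<open>G\<close> vanishes at all indices outside \<open>S\<close> that have an edge into \<open>S\<close>, and these zeros propagate
backwards along paths. As \<open>G\<close> has a positive diagonal, no index from \<open>t\<close> on has access to \<open>S\<close>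
(\<open>no_access_from_annihilated_rows\<close>). The transposed factorization gives the statement about indices that are accessed
by \<open>S\<close>. So each pair in \<open>chi A\<close> lies in one block of \<open>B\<close>.\<close>

section \<open>M-matrices, access and classes on an index set\<close>

text \<open>The principal submatrix of \<open>a\<close> on \<open>I\<close> is an M-matrix. The second condition says that
\<open>P z \<ge> (\<alpha> + \<delta>) z\<close> has no nonzero solution \<open>z \<ge> 0\<close> when \<open>a\<close> is written as
\<open>\<alpha> I - P\<close> with \<open>P \<ge> 0\<close> and \<open>\<delta> > 0\<close>; this expresses that the spectral radius of \<open>P\<close> is at most
\<open>\<alpha>\<close> without mentioning eigenvalues.\<close>

definition m_matrix_on :: "'i set \<Rightarrow> ('i \<Rightarrow> 'i \<Rightarrow> real) \<Rightarrow> bool" where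
  "m_matrix_on I a \<longleftrightarrow> (\<forall>i\<in>I. \<forall>j\<in>I. i \<noteq> j \<longrightarrow> a i j \<le> 0) \<and>
     (\<forall>z \<delta>. 0 < \<delta> \<and> (\<forall>i\<in>I. 0 \<le> z i) \<and> (\<forall>i\<in>I. (\<Sum>j\<in>I. a i j * z j) \<le> - \<delta> * z i)
        \<longrightarrow> (\<forall>i\<in>I. z i = 0))"

text \<open>The edges of the digraph of the principal submatrix on \<open>I\<close>. Access is membership in the
reflexive transitive closure of this relation.\<close>

definition edges_on :: "'i set \<Rightarrow> ('i \<Rightarrow> 'i \<Rightarrow> real) \<Rightarrow> 'i rel" where
  "edges_on I a = {(i, j). i \<in> I \<and> j \<in> I \<and> a i j \<noteq> 0}"

text \<open>The class that contains \<open>i\<close>, for \<open>i \<in> I\<close>.\<close>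

definition class_on :: "'i set \<Rightarrow> ('i \<Rightarrow> 'i \<Rightarrow> real) \<Rightarrow> 'i \<Rightarrow> 'i set" where
  "class_on I a i = {j \<in> I. (i, j) \<in> (edges_on I a)\<^sup>* \<and> (j, i) \<in> (edges_on I a)\<^sup>*}"

text \<open>The principal submatrix on \<open>S\<close> has a nonzero null vector.\<close>

definition singular_on :: "'i set \<Rightarrow> ('i \<Rightarrow> 'i \<Rightarrow> real) \<Rightarrow> bool" where
  "singular_on S a \<longleftrightarrow> (\<exists>x. (\<exists>i\<in>S. x i \<noteq> 0) \<and> (\<forall>i\<in>S. (\<Sum>j\<in>S. a i j * x j) = 0))"

text \<open>The index \<open>\<mu>\<close> is the maximum of a singular class of the principal submatrix on \<open>I\<close>.\<close>

definition singular_max_on :: "nat set \<Rightarrow> (nat \<Rightarrow> nat \<Rightarrow> real) \<Rightarrow> nat \<Rightarrow> bool" where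
  "singular_max_on I a \<mu> \<longleftrightarrow> \<mu> \<in> I \<and> (\<forall>j\<in>class_on I a \<mu>. j \<le> \<mu>) \<and> singular_on (class_on I a \<mu>) a"

text \<open>The zero pattern \<open>chi\<close>, relative to the principal submatrix on \<open>I\<close>.\<close>

definition chi_on :: "nat set \<Rightarrow> (nat \<Rightarrow> nat \<Rightarrow> real) \<Rightarrow> nat \<Rightarrow> nat \<Rightarrow> bool" where
  "chi_on I a i j \<longleftrightarrow> (i = j \<and> \<not> singular_max_on I a i) \<or>
     (singular_max_on I a j \<and> j < i \<and> (i, j) \<in> (edges_on I a)\<^sup>*) \<or>
     (singular_max_on I a i \<and> i < j \<and> (i, j) \<in> (edges_on I a)\<^sup>*)"

lemma m_matrix_onD:
  assumes "m_matrix_on I a" and "0 < \<delta>" and "\<And>i. i \<in> I \<Longrightarrow> 0 \<le> z i"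
    and "\<And>i. i \<in> I \<Longrightarrow> (\<Sum>j\<in>I. a i j * z j) \<le> - \<delta> * z i" and "i \<in> I"
  shows "z i = 0"
  using assms unfolding m_matrix_on_def by blast

lemma m_matrix_on_off_diagonal:
  "m_matrix_on I a \<Longrightarrow> i \<in> I \<Longrightarrow> j \<in> I \<Longrightarrow> i \<noteq> j \<Longrightarrow> a i j \<le> 0"
  unfolding m_matrix_on_def by blast

lemma m_matrix_onI:
  assumes "\<And>i j. i \<in> I \<Longrightarrow> j \<in> I \<Longrightarrow> i \<noteq> j \<Longrightarrow> a i j \<le> 0"
    and "\<And>z \<delta> i. 0 < \<delta> \<Longrightarrow> (\<And>i. i \<in> I \<Longrightarrow> 0 \<le> z i) \<Longrightarrow>
      (\<And>i. i \<in> I \<Longrightarrow> (\<Sum>j\<in>I. a i j * z j) \<le> - \<delta> * z i) \<Longrightarrow> i \<in> I \<Longrightarrow> z i = 0"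
  shows "m_matrix_on I a"
  unfolding m_matrix_on_def using assms by blast

lemma m_matrix_on_cong:
  assumes "\<And>i j. i \<in> I \<Longrightarrow> j \<in> I \<Longrightarrow> a i j = b i j"
  shows "m_matrix_on I a \<longleftrightarrow> m_matrix_on I b"
  unfolding m_matrix_on_def using assms by simp

lemma m_matrix_on_subset:
  assumes M: "m_matrix_on I a" and "finite I" and JI: "J \<subseteq> I"
  shows "m_matrix_on J a"
proof (rule m_matrix_onI)
  fix i j assume "i \<in> J" "j \<in> J" "i \<noteq> j"
  then show "a i j \<le> 0" using m_matrix_on_off_diagonal[OF M] JI by blast
next
  fix z \<delta> i
  assume d: "(0::real) < \<delta>" and z: "\<And>i. i \<in> J \<Longrightarrow> 0 \<le> z i"
    and le: "\<And>i. i \<in> J \<Longrightarrow> (\<Sum>j\<in>J. a i j * z j) \<le> - \<delta> * z i" and i: "i \<in> J"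
  \<comment> \<open>Extension by zero keeps the inequality in the new rows, as their entries are off-diagonal.\<close>
  let ?y = "\<lambda>i. if i \<in> J then z i else 0"
  have sum: "(\<Sum>j\<in>I. a k j * ?y j) = (\<Sum>j\<in>J. a k j * z j)" for k
    by (rule sum.mono_neutral_cong_right) (use \<open>finite I\<close> JI in auto)
  have "?y i = 0"
  proof (rule m_matrix_onD[OF M d])
    fix k assume k: "k \<in> I"
    show "0 \<le> ?y k" using z by simp
    show "(\<Sum>j\<in>I. a k j * ?y j) \<le> - \<delta> * ?y k"
    proof (cases "k \<in> J")
      case True then show ?thesis using le sum by simp
    next
      case False
      have "(\<Sum>j\<in>J. a k j * z j) \<le> 0"
        by (rule sum_nonpos, rule mult_nonpos_nonneg)
          (use False JI k z m_matrix_on_off_diagonal[OF M k] in auto)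
      then show ?thesis using False sum by simp
    qed
  qed (use i JI in auto)
  then show "z i = 0" using i by simp
qed

lemma m_matrix_on_diagonal_nonneg:
  assumes M: "m_matrix_on I a" and "finite I" and "i \<in> I"
  shows "0 \<le> a i i"
proof (rule ccontr)
  assume neg: "\<not> 0 \<le> a i i"
  have "m_matrix_on {i} a" using m_matrix_on_subset[OF assms(1,2)] \<open>i \<in> I\<close> by simp
  from m_matrix_onD[OF this, of "- a i i" "\<lambda>_. 1" i] neg show False by simp
qed

text \<open>A vector \<open>z \<ge> 0\<close> with \<open>b z \<le> - \<delta> z\<close> vanishes on \<open>J\<close>, because the rows in \<open>J\<close> involve \<open>J\<close> only,
and then on \<open>K\<close>.\<close>

lemma m_matrix_on_block_triangular:
  assumes J: "m_matrix_on J b" and K: "m_matrix_on K b" and fin: "finite J" "finite K"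
    and disj: "J \<inter> K = {}" and zero: "\<And>i j. i \<in> J \<Longrightarrow> j \<in> K \<Longrightarrow> b i j = 0"
    and neg: "\<And>i j. i \<in> K \<Longrightarrow> j \<in> J \<Longrightarrow> b i j \<le> 0"
  shows "m_matrix_on (J \<union> K) b"
proof (rule m_matrix_onI)
  fix i j assume "i \<in> J \<union> K" "j \<in> J \<union> K" "i \<noteq> j"
  then show "b i j \<le> 0"
    using zero neg m_matrix_on_off_diagonal[OF J] m_matrix_on_off_diagonal[OF K] by fastforce
next
  fix z \<delta> i
  assume d: "(0::real) < \<delta>" and z: "\<And>i. i \<in> J \<union> K \<Longrightarrow> 0 \<le> z i"
    and le: "\<And>i. i \<in> J \<union> K \<Longrightarrow> (\<Sum>j\<in>J \<union> K. b i j * z j) \<le> - \<delta> * z i" and i: "i \<in> J \<union> K"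
  have split: "(\<Sum>j\<in>J \<union> K. b i j * z j) = (\<Sum>j\<in>J. b i j * z j) + (\<Sum>j\<in>K. b i j * z j)" for i
    by (rule sum.union_disjoint) (use fin disj in auto)
  have zJ: "z k = 0" if "k \<in> J" for k
  proof (rule m_matrix_onD[OF J d _ _ that])
    fix k assume k: "k \<in> J"
    then show "0 \<le> z k" using z by simp
    show "(\<Sum>j\<in>J. b k j * z j) \<le> - \<delta> * z k" using le[of k] split[of k] k zero by simp
  qed
  have "z k = 0" if "k \<in> K" for k
  proof (rule m_matrix_onD[OF K d _ _ that])
    fix k assume k: "k \<in> K"
    then show "0 \<le> z k" using z by simp
    show "(\<Sum>j\<in>K. b k j * z j) \<le> - \<delta> * z k" using le[of k] split[of k] k zJ by simp
  qed
  then show "z i = 0" using zJ i by blast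
qed

section \<open>Null vectors of singular irreducible M-matrices\<close>

lemma finite_scaling_constant:
  fixes f g :: "'i \<Rightarrow> real"
  assumes "finite S" and "\<And>i. i \<in> S \<Longrightarrow> 0 \<le> f i" and "\<And>i. i \<in> S \<Longrightarrow> 0 < g i \<Longrightarrow> 0 < f i"
  shows "\<exists>\<delta>>0. \<forall>i\<in>S. \<delta> * g i \<le> f i"
  using assms
proof (induction S)
  case empty
  show ?case by (rule exI[of _ 1]) simp
next
  case (insert s S)
  then obtain \<delta> where \<delta>: "0 < \<delta>" "\<forall>i\<in>S. \<delta> * g i \<le> f i" by auto
  have "\<exists>\<eta>>0. \<eta> * g s \<le> f s"
  proof (cases "0 < g s")
    case True
    then show ?thesis using insert.prems(2)[of s] by (intro exI[of _ "f s / g s"]) simp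
  next
    case False
    then show ?thesis using insert.prems(1)[of s] by (intro exI[of _ 1]) auto
  qed
  then obtain \<eta> where \<eta>: "0 < \<eta>" "\<eta> * g s \<le> f s" by blast
  have min: "min \<delta> \<eta> * x \<le> y" if "\<delta> * x \<le> y \<or> \<eta> * x \<le> y" "0 \<le> y" for x y :: real
  proof (cases "0 \<le> x")
    case True
    then have "min \<delta> \<eta> * x \<le> \<delta> * x" "min \<delta> \<eta> * x \<le> \<eta> * x" by (auto intro: mult_right_mono)
    then show ?thesis using that by linarith
  next
    case False
    then have "min \<delta> \<eta> * x \<le> 0" using \<delta> \<eta> by (simp add: mult_nonneg_nonpos)
    then show ?thesis using that by linarith
  qed
  show ?case
    by (rule exI[of _ "min \<delta> \<eta>"]) (use \<delta> \<eta> insert.prems(1) min in auto)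
qed

lemma rtrancl_crosses:
  assumes "(k, i) \<in> r\<^sup>*" and "k \<notin> T" and "i \<in> T"
  shows "\<exists>x y. (x, y) \<in> r \<and> x \<notin> T \<and> y \<in> T"
  using assms by (induction rule: rtrancl_induct) auto

text \<open>If some row of \<open>a z \<le> 0\<close> is strict, then increasing one coordinate of \<open>z\<close> slightly makes a neighbouring
row strict as well. Irreducibility lets this go on until all rows are strict, which contradicts the
definition of an M-matrix.\<close>

lemma irreducible_m_matrix_kernel:
  assumes M: "m_matrix_on S a" and fin: "finite S"
    and conn: "\<And>i j. i \<in> S \<Longrightarrow> j \<in> S \<Longrightarrow> (i, j) \<in> (edges_on S a)\<^sup>*"
    and nonneg: "\<And>i. i \<in> S \<Longrightarrow> 0 \<le> z i" and nz: "\<exists>i\<in>S. z i \<noteq> 0"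
    and le: "\<And>i. i \<in> S \<Longrightarrow> (\<Sum>j\<in>S. a i j * z j) \<le> 0" and s: "s \<in> S"
  shows "(\<Sum>j\<in>S. a s j * z j) = 0"
proof (rule ccontr)
  assume "(\<Sum>j\<in>S. a s j * z j) \<noteq> 0"
  then have "(\<Sum>j\<in>S. a s j * z j) < 0" using le[OF s] by simp
  with nonneg nz le s show False
  proof (induction "card {i\<in>S. \<not> (\<Sum>j\<in>S. a i j * z j) < 0}" arbitrary: z s rule: less_induct)
    case less
    let ?A = "\<lambda>z i. \<Sum>j\<in>S. a i j * z j"
    let ?T = "{i\<in>S. ?A z i < 0}"
    show False
    proof (cases "?T = S")
      case True
      then have "0 < - ?A z i" if "i \<in> S" for i using that by auto
      then obtain \<delta> where \<delta>: "0 < \<delta>" "\<forall>i\<in>S. \<delta> * z i \<le> - ?A z i"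
        using finite_scaling_constant[OF fin, of "\<lambda>i. - ?A z i" z] by (auto dest: less_imp_le)
      have "z i = 0" if "i \<in> S" for i
        by (rule m_matrix_onD[OF M \<delta>(1) less.prems(1) _ that]) (use \<delta>(2) in auto)
      then show False using less.prems(2) by blast
    next
      case False
      then obtain k where k: "k \<in> S" "k \<notin> ?T" by blast
      obtain x y where xy: "(x, y) \<in> edges_on S a" "x \<notin> ?T" "y \<in> ?T"
        using rtrancl_crosses[OF conn[OF k(1) less.prems(4)], of ?T] k less.prems(4,5) by auto
      then have x: "x \<in> S" "y \<in> S" "x \<noteq> y" "a x y \<noteq> 0" unfolding edges_on_def by auto
      \<comment> \<open>The increase \<open>\<eta>\<close> of coordinate \<open>y\<close> leaves row \<open>y\<close> strict and makes row \<open>x\<close> strict.\<close>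
      define \<eta> where "\<eta> = - ?A z y / (\<bar>a y y\<bar> + 1)"
      have \<eta>: "0 < \<eta>" unfolding \<eta>_def using xy(3) by (simp add: divide_neg_pos)
      define w where "w = (\<lambda>i. z i + (if i = y then \<eta> else 0))"
      have Aw: "?A w i = ?A z i + \<eta> * a i y" for i
      proof -
        have "?A w i = (\<Sum>j\<in>S. a i j * z j + (if j = y then \<eta> * a i y else 0))"
          by (rule sum.cong) (auto simp: w_def algebra_simps)
        then show ?thesis using x(2) fin by (simp add: sum.distrib)
      qed
      have "\<eta> * a y y \<le> \<eta> * \<bar>a y y\<bar>" using \<eta> by simp
      also have "\<dots> < \<eta> * (\<bar>a y y\<bar> + 1)" using \<eta> by simp
      also have "\<dots> = - ?A z y" unfolding \<eta>_def by (simp add: add_nonneg_eq_0_iff)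
      finally have Awy: "?A w y < 0" using Aw by simp
      have Awi: "?A w i \<le> ?A z i" if "i \<in> S" "i \<noteq> y" for i
        using Aw m_matrix_on_off_diagonal[OF M that(1) x(2) that(2)] \<eta> by (simp add: mult_nonneg_nonpos)
      have "a x y < 0" using m_matrix_on_off_diagonal[OF M x(1,2,3)] x(4) by simp
      then have Awx: "?A w x < 0"
        using Aw[of x] less.prems(3)[OF x(1)] mult_pos_neg[OF \<eta>] by fastforce
      show False
      proof (rule less.hyps[of w y])
        have "{i\<in>S. \<not> ?A w i < 0} \<subset> {i\<in>S. \<not> ?A z i < 0}"
          using Awi Awy Awx x xy(2) by fastforce
        then show "card {i\<in>S. \<not> ?A w i < 0} < card {i\<in>S. \<not> ?A z i < 0}"
          using fin by (intro psubset_card_mono) auto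
        show "0 \<le> w i" if "i \<in> S" for i using less.prems(1)[OF that] \<eta> by (simp add: w_def)
        show "\<exists>i\<in>S. w i \<noteq> 0"
          using x(2) \<eta> less.prems(1)[OF x(2)] by (intro bexI[of _ y]) (auto simp: w_def)
        show "?A w i \<le> 0" if "i \<in> S" for i
          using Awi[OF that] Awy less.prems(3)[OF that] by (cases "i = y") auto
      qed (use x Awy in auto)
    qed
  qed
qed

text \<open>The positive null vector is the entrywise absolute value of an arbitrary nonzero null vector.\<close>

lemma singular_irreducible_null_vector:
  assumes M: "m_matrix_on S a" and fin: "finite S"
    and conn: "\<And>i j. i \<in> S \<Longrightarrow> j \<in> S \<Longrightarrow> (i, j) \<in> (edges_on S a)\<^sup>*"
    and sing: "singular_on S a"
  obtains z where "\<And>i. i \<in> S \<Longrightarrow> 0 < z i" and "\<And>i. i \<in> S \<Longrightarrow> (\<Sum>j\<in>S. a i j * z j) = 0"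
proof -
  obtain x where x: "\<exists>i\<in>S. x i \<noteq> 0" "\<And>i. i \<in> S \<Longrightarrow> (\<Sum>j\<in>S. a i j * x j) = 0"
    using sing unfolding singular_on_def by blast
  let ?z = "\<lambda>i. \<bar>x i\<bar>"
  have le: "(\<Sum>j\<in>S. a i j * ?z j) \<le> 0" if i: "i \<in> S" for i
  proof -
    have split: "(\<Sum>j\<in>S. a i j * y j) = a i i * y i + (\<Sum>j\<in>S - {i}. a i j * y j)" for y
      using fin i by (rule sum.remove)
    have "a i i * ?z i = \<bar>a i i * x i\<bar>"
      using m_matrix_on_diagonal_nonneg[OF M fin i] by (simp add: abs_mult)
    also have "\<dots> = \<bar>\<Sum>j\<in>S - {i}. a i j * x j\<bar>"
      using x(2)[OF i] split[of x] by (simp add: eq_neg_iff_add_eq_0)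
    also have "\<dots> \<le> (\<Sum>j\<in>S - {i}. \<bar>a i j * x j\<bar>)" by (rule sum_abs)
    also have "\<dots> = (\<Sum>j\<in>S - {i}. - (a i j * ?z j))"
      by (rule sum.cong) (use m_matrix_on_off_diagonal[OF M i] in \<open>auto simp: abs_mult abs_of_nonpos\<close>)
    finally show ?thesis unfolding split[of ?z] by (simp add: sum_negf)
  qed
  have eq: "(\<Sum>j\<in>S. a i j * ?z j) = 0" if "i \<in> S" for i
    using irreducible_m_matrix_kernel[OF M fin conn, where z = ?z] le x(1) that by auto
  have "0 < ?z i" if i: "i \<in> S" for i
  proof (rule ccontr)
    assume "\<not> 0 < ?z i"
    then have "x i = 0" by simp
    obtain k where k: "k \<in> S" "x k \<noteq> 0" using x(1) by blast
    obtain p q where pq: "(p, q) \<in> edges_on S a" "x p = 0" "x q \<noteq> 0"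
      using rtrancl_crosses[OF conn[OF i k(1)], of "{i. x i \<noteq> 0}"] \<open>x i = 0\<close> k by auto
    then have p: "p \<in> S" "q \<in> S" "a p q \<noteq> 0" unfolding edges_on_def by auto
    have "(\<Sum>j\<in>S. - (a p j * ?z j)) = 0" using eq[OF p(1)] by (simp add: sum_negf)
    moreover have "0 \<le> - (a p j * ?z j)" if "j \<in> S" for j
      using m_matrix_on_off_diagonal[OF M p(1) that] pq(2)
      by (cases "j = p") (auto intro: mult_nonpos_nonneg)
    ultimately have "a p q * ?z q = 0"
      using sum_nonneg_eq_0_iff[OF fin, of "\<lambda>j. - (a p j * ?z j)"] p(2) by auto
    then show False using p(3) pq(3) by simp
  qed
  then show thesis using that[of ?z] eq by blast
qed

lemma rtrancl_edges_on_mono: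
  assumes "(i, j) \<in> (edges_on I a)\<^sup>*" and "\<And>i j. (i, j) \<in> edges_on I a \<Longrightarrow> (i, j) \<in> (edges_on J b)\<^sup>*"
  shows "(i, j) \<in> (edges_on J b)\<^sup>*"
  using assms(1) by (induction rule: rtrancl_induct) (auto intro: rtrancl_trans assms(2))

lemma class_on_self [simp]: "i \<in> I \<Longrightarrow> i \<in> class_on I a i"
  unfolding class_on_def by simp

lemma class_on_subset: "class_on I a i \<subseteq> I"
  unfolding class_on_def by auto

text \<open>Paths between members of a class stay in the class, so the principal submatrix on a class is irreducible.\<close>

lemma class_on_connected:
  assumes "i \<in> class_on I a s" and "j \<in> class_on I a s"
  shows "(i, j) \<in> (edges_on (class_on I a s) a)\<^sup>*"
proof -
  let ?E = "(edges_on I a)\<^sup>*"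
  have *: "i \<in> I" "(i, s) \<in> ?E" "(s, i) \<in> ?E" "(s, j) \<in> ?E" "(j, s) \<in> ?E"
    using assms unfolding class_on_def by auto
  have "(i, k) \<in> ?E \<Longrightarrow> (k, s) \<in> ?E \<Longrightarrow> (i, k) \<in> (edges_on (class_on I a s) a)\<^sup>*" for k
  proof (induction rule: rtrancl_induct)
    case (step x y)
    have xs: "(x, s) \<in> ?E" using step by (meson converse_rtrancl_into_rtrancl)
    have "(s, x) \<in> ?E" "(s, y) \<in> ?E" using *(3) step by (meson rtrancl_trans rtrancl.rtrancl_into_rtrancl)+
    then have "(x, y) \<in> edges_on (class_on I a s) a"
      using xs step unfolding class_on_def edges_on_def by auto
    then show ?case using step.IH[OF xs] by simp
  qed simp
  then show ?thesis using * by (meson rtrancl_trans)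
qed

section \<open>Elimination of one index\<close>

text \<open>The Schur complement of the diagonal entry at \<open>p\<close>, to be used at indices other than \<open>p\<close>.\<close>

definition schur_complement :: "'i \<Rightarrow> ('i \<Rightarrow> 'i \<Rightarrow> real) \<Rightarrow> 'i \<Rightarrow> 'i \<Rightarrow> real" where
  "schur_complement p a i j = a i j - a i p * a p j / a p p"

lemma schur_complement_sum:
  assumes "finite I"
  shows "(\<Sum>j\<in>I. schur_complement p a i j * z j) =
    (\<Sum>j\<in>I. a i j * z j) + a i p * (- (\<Sum>j\<in>I. a p j * z j) / a p p)"
proof -
  have "(\<Sum>j\<in>I. schur_complement p a i j * z j) =
      (\<Sum>j\<in>I. a i j * z j - (a i p / a p p) * (a p j * z j))"
    by (rule sum.cong) (auto simp: schur_complement_def algebra_simps)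
  also have "\<dots> = (\<Sum>j\<in>I. a i j * z j) - (a i p / a p p) * (\<Sum>j\<in>I. a p j * z j)"
    by (simp add: sum_subtractf sum_distrib_left)
  finally show ?thesis by simp
qed

lemma schur_complement_correction_nonpos:
  assumes "m_matrix_on (insert p I) a" and "p \<notin> I" and "0 < a p p" and "i \<in> I" and "j \<in> I"
  shows "- (a i p * a p j / a p p) \<le> 0"
proof -
  have "a i p \<le> 0" "a p j \<le> 0"
    using m_matrix_on_off_diagonal[OF assms(1)] assms(2,4,5) by auto
  then show ?thesis using assms(3) by (simp add: mult_nonpos_nonpos)
qed

text \<open>A vector \<open>z\<close> that violates the condition for the Schur complement extends to a vector that violates it
for \<open>a\<close>. The entry \<open>y\<close> that solves row \<open>p\<close> is not quite sufficient, since row \<open>p\<close> then becomes zero; it is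
shrunk by a factor \<open>1 - \<eta>\<close> so close to 1 that row \<open>k\<close> increases by at most \<open>\<delta> / 2 * z k\<close> where \<open>z k > 0\<close>.\<close>

lemma m_matrix_on_schur_complement:
  assumes M: "m_matrix_on (insert p I) a" and p: "p \<notin> I" and fin: "finite I" and pos: "0 < a p p"
  shows "m_matrix_on I (schur_complement p a)"
proof (rule m_matrix_onI)
  fix i j assume ij: "i \<in> I" "j \<in> I" "i \<noteq> j"
  have "a i j \<le> 0" using m_matrix_on_off_diagonal[OF M] ij by simp
  then show "schur_complement p a i j \<le> 0"
    using schur_complement_correction_nonpos[OF M p pos ij(1,2)] unfolding schur_complement_def by simp
next
  fix z \<delta> i
  assume d: "(0::real) < \<delta>" and z: "\<And>i. i \<in> I \<Longrightarrow> 0 \<le> z i"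
    and le: "\<And>i. i \<in> I \<Longrightarrow> (\<Sum>j\<in>I. schur_complement p a i j * z j) \<le> - \<delta> * z i" and i: "i \<in> I"
  define y where "y = - (\<Sum>j\<in>I. a p j * z j) / a p p"
  have ip: "a k p \<le> 0" if "k \<in> I" for k using m_matrix_on_off_diagonal[OF M, of k p] that p by auto
  have "(\<Sum>j\<in>I. a p j * z j) \<le> 0"
    by (rule sum_nonpos, rule mult_nonpos_nonneg) (use m_matrix_on_off_diagonal[OF M, of p] p z in auto)
  then have y: "0 \<le> y" unfolding y_def using pos by (simp add: divide_nonpos_pos)
  have row_p: "(\<Sum>j\<in>I. a p j * z j) = - (a p p * y)" unfolding y_def using pos by simp
  have row: "(\<Sum>j\<in>I. schur_complement p a k j * z j) = (\<Sum>j\<in>I. a k j * z j) + a k p * y" for k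
    unfolding y_def by (rule schur_complement_sum[OF fin])
  have dz: "0 \<le> \<delta> / 2 * z k" if "k \<in> I" for k using d z[OF that] by simp
  obtain \<epsilon> where \<epsilon>: "0 < \<epsilon>" "\<forall>k\<in>I. \<epsilon> * (if 0 < z k then - a k p * y else 0) \<le> \<delta> / 2 * z k"
    using finite_scaling_constant[OF fin dz, where g = "\<lambda>k. if 0 < z k then - a k p * y else 0"] d
    by (force split: if_splits)
  define \<eta> where "\<eta> = min \<epsilon> 1"
  have \<eta>: "0 < \<eta>" "\<eta> \<le> 1" "\<eta> \<le> \<epsilon>" using \<epsilon>(1) by (auto simp: \<eta>_def)
  define \<theta> where "\<theta> = min (\<delta> / 2) (\<eta> * a p p)"
  have \<theta>: "0 < \<theta>" "\<theta> \<le> \<delta> / 2" "\<theta> \<le> \<eta> * a p p" using d \<eta> pos by (auto simp: \<theta>_def)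
  define w where "w = (\<lambda>j. if j = p then (1 - \<eta>) * y else z j)"
  have sum_w: "(\<Sum>j\<in>insert p I. a k j * w j) = a k p * ((1 - \<eta>) * y) + (\<Sum>j\<in>I. a k j * z j)" for k
  proof -
    have "(\<Sum>j\<in>I. a k j * w j) = (\<Sum>j\<in>I. a k j * z j)"
      by (rule sum.cong) (use p in \<open>auto simp: w_def\<close>)
    then show ?thesis using fin p by (simp add: w_def)
  qed
  have "w i = 0"
  proof (rule m_matrix_onD[OF M \<theta>(1)])
    fix k assume k: "k \<in> insert p I"
    show "0 \<le> w k" using k z y \<eta> by (auto simp: w_def)
    show "(\<Sum>j\<in>insert p I. a k j * w j) \<le> - \<theta> * w k"
    proof (cases "k = p")
      case True
      have "\<theta> * ((1 - \<eta>) * y) \<le> (\<eta> * a p p) * (1 * y)"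
        by (intro mult_mono) (use \<theta> \<eta> y pos in auto)
      then show ?thesis unfolding True sum_w row_p by (simp add: w_def algebra_simps)
    next
      case False
      with k have kI: "k \<in> I" by simp
      then have wk: "w k = z k" using p by (auto simp: w_def)
      show ?thesis
      proof (cases "0 < z k")
        case True
        have "0 \<le> - a k p * y" using ip[OF kI] y by (simp add: mult_nonpos_nonneg)
        then have "\<eta> * (- a k p * y) \<le> \<epsilon> * (- a k p * y)" using \<eta>(3) by (intro mult_right_mono) auto
        then have "\<eta> * (- a k p * y) \<le> \<delta> / 2 * z k" using \<epsilon>(2) kI True by force
        moreover have "\<theta> * z k \<le> \<delta> / 2 * z k" using \<theta>(2) True by (intro mult_right_mono) auto
        ultimately show ?thesis using le[OF kI] row[of k] unfolding sum_w wk by (simp add: algebra_simps)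
      next
        \<comment> \<open>Where \<open>z\<close> vanishes nothing has to be gained: all terms of the row are nonpositive.\<close>
        case False
        then have "z k = 0" using z[OF kI] by simp
        have "(\<Sum>j\<in>I. a k j * z j) \<le> 0"
        proof (rule sum_nonpos)
          fix j assume "j \<in> I"
          then show "a k j * z j \<le> 0"
            using m_matrix_on_off_diagonal[OF M, of k j] kI z \<open>z k = 0\<close>
            by (cases "j = k") (auto intro: mult_nonpos_nonneg)
        qed
        moreover have "a k p * ((1 - \<eta>) * y) \<le> 0"
          using ip[OF kI] y \<eta> by (simp add: mult_nonpos_nonneg)
        ultimately show ?thesis unfolding sum_w wk \<open>z k = 0\<close> by simp
      qed
    qed
  qed (use i in simp)
  then show "z i = 0" using i p by (auto simp: w_def split: if_splits)
qed

text \<open>Elimination only replaces paths through \<open>p\<close> by edges. No edge gets lost, because both terms of an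
off-diagonal entry of the Schur complement are nonpositive and cannot cancel.\<close>

lemma schur_complement_access:
  assumes M: "m_matrix_on (insert p I) a" and p: "p \<notin> I" and pos: "0 < a p p"
    and i: "i \<in> I" and j: "j \<in> I"
  shows "(i, j) \<in> (edges_on I (schur_complement p a))\<^sup>* \<longleftrightarrow> (i, j) \<in> (edges_on (insert p I) a)\<^sup>*"
    (is "_ \<in> ?S\<^sup>* \<longleftrightarrow> _ \<in> ?E\<^sup>*")
proof
  assume "(i, j) \<in> ?S\<^sup>*"
  then show "(i, j) \<in> ?E\<^sup>*"
  proof (rule rtrancl_edges_on_mono)
    fix i j assume "(i, j) \<in> ?S"
    then have ij: "i \<in> I" "j \<in> I" "schur_complement p a i j \<noteq> 0" unfolding edges_on_def by auto
    then have "a i j \<noteq> 0 \<or> a i p \<noteq> 0 \<and> a p j \<noteq> 0" unfolding schur_complement_def by auto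
    then have "(i, j) \<in> ?E \<or> (i, p) \<in> ?E \<and> (p, j) \<in> ?E" using ij unfolding edges_on_def by auto
    then show "(i, j) \<in> ?E\<^sup>*" by (meson r_into_rtrancl rtrancl.rtrancl_into_rtrancl)
  qed
next
  have edge: "(x, y) \<in> ?S\<^sup>*" if "x \<in> I" "y \<in> I" "a x y \<noteq> 0 \<or> a x p \<noteq> 0 \<and> a p y \<noteq> 0" for x y
  proof (cases "x = y")
    case False
    have "a x y \<le> 0" "a x p \<le> 0" "a p y \<le> 0"
      using m_matrix_on_off_diagonal[OF M] that False p by auto
    then have "a x y < 0 \<or> a x p < 0 \<and> a p y < 0" using that(3) by auto
    then have "a x y < 0 \<or> - (a x p * a p y / a p p) < 0"
      using pos by (auto simp: mult_neg_neg)
    then have "schur_complement p a x y \<noteq> 0"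
      using \<open>a x y \<le> 0\<close> schur_complement_correction_nonpos[OF M p pos that(1,2)]
      unfolding schur_complement_def by linarith
    then show ?thesis using that unfolding edges_on_def by auto
  qed simp
  assume "(i, j) \<in> ?E\<^sup>*"
  \<comment> \<open>Induction along the path; a prefix that ends at \<open>p\<close> is represented by the vertex before \<open>p\<close>.\<close>
  then have "if j = p then \<exists>k\<in>I. (i, k) \<in> ?S\<^sup>* \<and> a k p \<noteq> 0 else (i, j) \<in> ?S\<^sup>*"
  proof (induction rule: rtrancl_induct)
    case base
    then show ?case using i p by auto
  next
    case (step x y)
    have xy: "x \<in> insert p I" "y \<in> insert p I" "a x y \<noteq> 0" using step(2) unfolding edges_on_def by auto
    consider "y = p" "x = p" | "y = p" "x \<in> I" | "y \<in> I" "x = p" | "y \<in> I" "x \<in> I"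
      using xy by blast
    then show ?case
    proof cases
      case 1 then show ?thesis using step.IH by simp
    next
      case 2
      then have "x \<noteq> p" using p by blast
      then show ?thesis using step.IH xy(3) 2 by auto
    next
      case 3
      then obtain k where "k \<in> I" "(i, k) \<in> ?S\<^sup>*" "a k p \<noteq> 0" using step.IH by auto
      then show ?thesis using edge[of k y] 3 xy(3) p by auto
    next
      case 4
      then have "x \<noteq> p" "y \<noteq> p" using p by auto
      then show ?thesis using step.IH edge[of x y] 4 xy(3) by auto
    qed
  qed
  then show "(i, j) \<in> ?S\<^sup>*" using j p by (auto split: if_splits)
qed

lemma class_on_schur_complement:
  assumes "m_matrix_on (insert p I) a" and "p \<notin> I" and "0 < a p p" and "i \<in> I"
  shows "class_on I (schur_complement p a) i = class_on (insert p I) a i - {p}"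
  using schur_complement_access[OF assms(1-3)] assms(2,4) unfolding class_on_def by auto

lemma singular_on_schur_complement:
  assumes p: "p \<notin> S" and fin: "finite S" and nz: "a p p \<noteq> 0"
  shows "singular_on S (schur_complement p a) \<longleftrightarrow> singular_on (insert p S) a"
proof
  assume "singular_on S (schur_complement p a)"
  then obtain x where x: "\<exists>i\<in>S. x i \<noteq> 0" "\<forall>i\<in>S. (\<Sum>j\<in>S. schur_complement p a i j * x j) = 0"
    unfolding singular_on_def by blast
  let ?y = "\<lambda>j. if j = p then - (\<Sum>j\<in>S. a p j * x j) / a p p else x j"
  have sum: "(\<Sum>j\<in>insert p S. a i j * ?y j) =
      a i p * (- (\<Sum>j\<in>S. a p j * x j) / a p p) + (\<Sum>j\<in>S. a i j * x j)" for i
  proof -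
    have "(\<Sum>j\<in>S. a i j * ?y j) = (\<Sum>j\<in>S. a i j * x j)" by (rule sum.cong) (use p in auto)
    then show ?thesis using fin p by simp
  qed
  have "(\<Sum>j\<in>insert p S. a i j * ?y j) = 0" if "i \<in> insert p S" for i
    using that x(2) schur_complement_sum[OF fin, of p a i x] nz unfolding sum by auto
  moreover have "\<exists>i\<in>insert p S. ?y i \<noteq> 0" using x(1) p by auto
  ultimately show "singular_on (insert p S) a" unfolding singular_on_def by (intro exI[of _ ?y]) auto
next
  assume "singular_on (insert p S) a"
  then obtain x where x: "\<exists>i\<in>insert p S. x i \<noteq> 0"
      "\<And>i. i \<in> insert p S \<Longrightarrow> a i p * x p + (\<Sum>j\<in>S. a i j * x j) = 0"
    unfolding singular_on_def using fin p by auto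
  have xp: "x p = - (\<Sum>j\<in>S. a p j * x j) / a p p"
    using x(2)[of p] nz by (simp add: field_simps eq_neg_iff_add_eq_0)
  have "(\<Sum>j\<in>S. schur_complement p a i j * x j) = 0" if "i \<in> S" for i
    using x(2)[of i] that schur_complement_sum[OF fin, of p a i x] unfolding xp[symmetric] by simp
  moreover have "\<exists>i\<in>S. x i \<noteq> 0"
  proof (rule ccontr)
    assume "\<not> (\<exists>i\<in>S. x i \<noteq> 0)"
    then show False using xp x(1) by simp
  qed
  ultimately show "singular_on S (schur_complement p a)" unfolding singular_on_def by blast
qed

lemma singular_on_cong:
  assumes "\<And>i j. i \<in> S \<Longrightarrow> j \<in> S \<Longrightarrow> a i j = b i j"
  shows "singular_on S a \<longleftrightarrow> singular_on S b"
  unfolding singular_on_def using assms by auto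

lemma singular_max_on_schur_complement:
  assumes M: "m_matrix_on (insert p I) a" and p: "\<And>i. i \<in> I \<Longrightarrow> p < i" and fin: "finite I"
    and pos: "0 < a p p" and \<mu>: "\<mu> \<in> I"
  shows "singular_max_on I (schur_complement p a) \<mu> \<longleftrightarrow> singular_max_on (insert p I) a \<mu>"
proof -
  let ?C = "class_on (insert p I) a \<mu>"
  have pI: "p \<notin> I" using p by blast
  have eq: "class_on I (schur_complement p a) \<mu> = ?C - {p}"
    by (rule class_on_schur_complement[OF M pI pos \<mu>])
  have finC: "finite ?C" using class_on_subset fin by (meson finite_insert finite_subset)
  have "singular_on (?C - {p}) (schur_complement p a) \<longleftrightarrow> singular_on ?C a"
  proof (cases "p \<in> ?C")
    case True
    then show ?thesis
      using singular_on_schur_complement[of p "?C - {p}" a] finC pos by (simp add: insert_absorb)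
  next
    case False
    have "schur_complement p a i j = a i j" if "i \<in> ?C" "j \<in> ?C" for i j
    proof (rule ccontr)
      assume "schur_complement p a i j \<noteq> a i j"
      then have "(i, p) \<in> edges_on (insert p I) a" "(p, j) \<in> edges_on (insert p I) a"
        using that class_on_subset[of "insert p I" a \<mu>] unfolding schur_complement_def edges_on_def by auto
      then have "p \<in> ?C" using that unfolding class_on_def
        by (auto intro: rtrancl_into_rtrancl converse_rtrancl_into_rtrancl)
      with False show False by blast
    qed
    then show ?thesis using False singular_on_cong[of ?C "schur_complement p a" a] by simp
  qed
  moreover have "(\<forall>j\<in>?C - {p}. j \<le> \<mu>) \<longleftrightarrow> (\<forall>j\<in>?C. j \<le> \<mu>)" using p[OF \<mu>] by auto
  ultimately show ?thesis unfolding singular_max_on_def eq using \<mu> by simp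
qed

lemma not_singular_max_on_first:
  assumes "\<And>i. i \<in> I \<Longrightarrow> p < i" and "a p p \<noteq> 0"
  shows "\<not> singular_max_on (insert p I) a p"
proof
  assume *: "singular_max_on (insert p I) a p"
  then have "j = p" if "j \<in> class_on (insert p I) a p" for j
    using that assms(1)[of j] class_on_subset[of "insert p I" a p]
    unfolding singular_max_on_def by fastforce
  then have "class_on (insert p I) a p = {p}" using class_on_self[of p "insert p I" a] by blast
  then have "singular_on {p} a" using * unfolding singular_max_on_def by simp
  then show False using assms(2) unfolding singular_on_def by simp
qed

text \<open>In an irreducible M-matrix with \<open>a p p = 0\<close> the unit vector at \<open>p\<close> is mapped to a nonpositive vector,
hence to zero. So column \<open>p\<close> vanishes, which irreducibility allows only if \<open>p\<close> is the sole index.\<close>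

lemma class_on_zero_diagonal:
  assumes M: "m_matrix_on I a" and fin: "finite I" and p: "p \<in> I" and zero: "a p p = 0"
  shows "class_on I a p = {p}"
proof (rule ccontr)
  let ?C = "class_on I a p"
  assume "?C \<noteq> {p}"
  then obtain k where k: "k \<in> ?C" "k \<noteq> p" using class_on_self[OF p, of a] by blast
  have pC: "p \<in> ?C" using p by simp
  obtain x y where "(x, y) \<in> edges_on ?C a" "x \<notin> {p}" "y \<in> {p}"
    using rtrancl_crosses[OF class_on_connected[OF k(1) pC], of "{p}"] k(2) by auto
  then have x: "x \<in> ?C" "x \<noteq> p" "a x p \<noteq> 0" unfolding edges_on_def by auto
  have finC: "finite ?C" using fin class_on_subset by (rule finite_subset[rotated])
  have MC: "m_matrix_on ?C a" by (rule m_matrix_on_subset[OF M fin class_on_subset])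
  have sum: "(\<Sum>j\<in>?C. a i j * (if j = p then 1 else 0)) = a i p" for i
    using finC pC by (simp add: if_distrib cong: if_cong)
  have "(\<Sum>j\<in>?C. a x j * (if j = p then 1 else 0)) = 0"
  proof (rule irreducible_m_matrix_kernel[OF MC finC])
    show "(i, j) \<in> (edges_on ?C a)\<^sup>*" if "i \<in> ?C" "j \<in> ?C" for i j
      using class_on_connected that .
    show "(\<Sum>j\<in>?C. a i j * (if j = p then 1 else 0)) \<le> 0" if "i \<in> ?C" for i
      unfolding sum using m_matrix_on_off_diagonal[OF MC that pC] zero by (cases "i = p") auto
  qed (use pC x in auto)
  then show False unfolding sum using x by simp
qed

lemma class_on_delete_trivial_class:
  assumes p: "p \<notin> I" and triv: "class_on (insert p I) a p = {p}" and i: "i \<in> I"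
  shows "class_on I a i = class_on (insert p I) a i"
proof
  show "class_on I a i \<subseteq> class_on (insert p I) a i"
  proof -
    have "edges_on I a \<subseteq> edges_on (insert p I) a" unfolding edges_on_def by auto
    then have "(edges_on I a)\<^sup>* \<subseteq> (edges_on (insert p I) a)\<^sup>*" by (rule rtrancl_mono)
    then show ?thesis unfolding class_on_def by auto
  qed
  let ?C = "class_on (insert p I) a i"
  have "p \<notin> ?C"
  proof
    assume "p \<in> ?C"
    then have "i \<in> class_on (insert p I) a p" using i unfolding class_on_def by auto
    then show False using triv p i by auto
  qed
  then have C: "?C \<subseteq> I" using class_on_subset[of "insert p I" a i] by auto
  then have "edges_on ?C a \<subseteq> edges_on I a" unfolding edges_on_def by auto
  then have mono: "(edges_on ?C a)\<^sup>* \<subseteq> (edges_on I a)\<^sup>*" by (rule rtrancl_mono)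
  have "i \<in> ?C" using i by simp
  then have "(i, j) \<in> (edges_on I a)\<^sup>* \<and> (j, i) \<in> (edges_on I a)\<^sup>*" if "j \<in> ?C" for j
    using class_on_connected[of _ "insert p I" a i] that mono by blast
  then show "?C \<subseteq> class_on I a i" using C unfolding class_on_def by auto
qed

section \<open>Unit triangular M-matrices and forward substitution\<close>

text \<open>Lower triangular with unit diagonal and nonpositive entries below it. Upper triangular functions are
treated by exchanging the arguments.\<close>

definition unit_lower_on :: "nat set \<Rightarrow> (nat \<Rightarrow> nat \<Rightarrow> real) \<Rightarrow> bool" where
  "unit_lower_on I l \<longleftrightarrow> (\<forall>i\<in>I. l i i = 1) \<and> (\<forall>i\<in>I. \<forall>j\<in>I. i < j \<longrightarrow> l i j = 0) \<and>
     (\<forall>i\<in>I. \<forall>j\<in>I. j < i \<longrightarrow> l i j \<le> 0)"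

lemma m_matrix_on_singleton: "0 \<le> a i i \<Longrightarrow> m_matrix_on {i} a"
proof (rule m_matrix_onI)
  fix z \<delta> k assume "0 \<le> a i i" "(0::real) < \<delta>" and z: "\<And>k. k \<in> {i} \<Longrightarrow> 0 \<le> z k"
    and le: "\<And>k. k \<in> {i} \<Longrightarrow> (\<Sum>j\<in>{i}. a k j * z j) \<le> - \<delta> * z k" and k: "k \<in> {i}"
  have "0 \<le> a i i * z i" using \<open>0 \<le> a i i\<close> z by simp
  then have "\<delta> * z i \<le> 0" using le[of i] by simp
  then show "z k = 0" using \<open>0 < \<delta>\<close> z[of i] k by (simp add: mult_le_0_iff)
qed auto

lemma unit_lower_on_m_matrix:
  assumes "finite I" and "unit_lower_on I l"
  shows "m_matrix_on I l"
  using assms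
proof (induction rule: finite_linorder_max_induct)
  case empty
  show ?case unfolding m_matrix_on_def by simp
next
  case (insert b A)
  then have "m_matrix_on (A \<union> {b}) l"
    by (intro m_matrix_on_block_triangular m_matrix_on_singleton) (auto simp: unit_lower_on_def)
  then show ?case by simp
qed

lemma unit_upper_on_m_matrix:
  assumes "finite I" and "unit_lower_on I (\<lambda>i j. u j i)"
  shows "m_matrix_on I u"
  using assms
proof (induction rule: finite_linorder_max_induct)
  case empty
  show ?case unfolding m_matrix_on_def by simp
next
  case (insert b A)
  then have "m_matrix_on ({b} \<union> A) u"
    by (intro m_matrix_on_block_triangular m_matrix_on_singleton) (auto simp: unit_lower_on_def)
  then show ?case by simp
qed

text \<open>Solving \<open>l x = c\<close> with \<open>c \<le> 0\<close> gives \<open>x \<le> 0\<close>, and \<open>x i \<noteq> 0\<close> only if \<open>i\<close> reaches some nonzero entry of \<open>c\<close>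
in every relation \<open>r\<close> whose reflexive transitive closure contains the edges of \<open>l\<close>.\<close>

lemma forward_substitution:
  assumes "finite I" and "unit_lower_on I l" and "\<And>i. i \<in> I \<Longrightarrow> c i \<le> 0"
    and "\<And>i j. i \<in> I \<Longrightarrow> j \<in> I \<Longrightarrow> l i j \<noteq> 0 \<Longrightarrow> (i, j) \<in> r\<^sup>*"
  shows "\<exists>x. \<forall>i\<in>I. (\<Sum>j\<in>I. l i j * x j) = c i \<and> x i \<le> 0 \<and>
           (x i \<noteq> 0 \<longrightarrow> (\<exists>k\<in>I. c k \<noteq> 0 \<and> (i, k) \<in> r\<^sup>*))"
  using assms
proof (induction rule: finite_linorder_max_induct)
  case (insert b A)
  have bA: "b \<notin> A" using insert.hyps by auto
  have "\<exists>x. \<forall>i\<in>A. (\<Sum>j\<in>A. l i j * x j) = c i \<and> x i \<le> 0 \<and>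
           (x i \<noteq> 0 \<longrightarrow> (\<exists>k\<in>A. c k \<noteq> 0 \<and> (i, k) \<in> r\<^sup>*))"
    using insert.prems by (intro insert.IH) (auto simp: unit_lower_on_def)
  then obtain x where x: "\<And>i. i \<in> A \<Longrightarrow> (\<Sum>j\<in>A. l i j * x j) = c i" "\<And>i. i \<in> A \<Longrightarrow> x i \<le> 0"
    "\<And>i. i \<in> A \<Longrightarrow> x i \<noteq> 0 \<Longrightarrow> \<exists>k\<in>A. c k \<noteq> 0 \<and> (i, k) \<in> r\<^sup>*" by blast
  define y where "y = (\<lambda>i. if i = b then c b - (\<Sum>j\<in>A. l b j * x j) else x i)"
  have sum: "(\<Sum>j\<in>insert b A. l i j * y j) = l i b * y b + (\<Sum>j\<in>A. l i j * x j)" for i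
  proof -
    have "(\<Sum>j\<in>A. l i j * y j) = (\<Sum>j\<in>A. l i j * x j)"
      by (rule sum.cong) (use bA in \<open>auto simp: y_def\<close>)
    then show ?thesis using insert.hyps(1) bA by simp
  qed
  have yA: "y i = x i" if "i \<in> A" for i using that bA by (auto simp: y_def)
  have "0 \<le> (\<Sum>j\<in>A. l b j * x j)"
    by (rule sum_nonneg, rule mult_nonpos_nonpos)
      (use insert.prems(1) insert.hyps(2) x(2) in \<open>auto simp: unit_lower_on_def\<close>)
  then have yb: "y b \<le> 0" using insert.prems(2)[of b] by (simp add: y_def)
  have eq: "(\<Sum>j\<in>insert b A. l i j * y j) = c i" if "i \<in> insert b A" for i
    using that insert.prems(1) insert.hyps(2) x(1) unfolding sum
    by (auto simp: unit_lower_on_def y_def)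
  have "\<exists>k\<in>insert b A. c k \<noteq> 0 \<and> (b, k) \<in> r\<^sup>*" if "y b \<noteq> 0"
  proof (cases "c b = 0")
    case True
    then have "(\<Sum>j\<in>A. l b j * x j) \<noteq> 0" using that by (simp add: y_def)
    then obtain j where "j \<in> A" "l b j * x j \<noteq> 0" by (meson sum.neutral)
    then obtain k where "k \<in> A" "c k \<noteq> 0" "(j, k) \<in> r\<^sup>*" "(b, j) \<in> r\<^sup>*"
      using x(3)[of j] insert.prems(3)[of b j] by auto
    then show ?thesis by (meson insertI2 rtrancl_trans)
  qed auto
  then have "y i \<noteq> 0 \<longrightarrow> (\<exists>k\<in>insert b A. c k \<noteq> 0 \<and> (i, k) \<in> r\<^sup>*)" if "i \<in> insert b A" for i
    using that x(3) yA by auto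
  moreover have "y i \<le> 0" if "i \<in> insert b A" for i using that yb x(2) yA by auto
  ultimately show ?case using eq by blast
qed simp

section \<open>The triangular factorization\<close>

lemma sum_triple_product_insert:
  fixes l b u :: "'i \<Rightarrow> 'i \<Rightarrow> real"
  assumes "finite I" and "p \<notin> I"
  shows "(\<Sum>k\<in>insert p I. \<Sum>m\<in>insert p I. l i k * b k m * u m j) =
    l i p * b p p * u p j + l i p * (\<Sum>m\<in>I. b p m * u m j) + (\<Sum>k\<in>I. l i k * b k p) * u p j +
    (\<Sum>k\<in>I. \<Sum>m\<in>I. l i k * b k m * u m j)"
  using assms by (simp add: sum.distrib sum_distrib_left sum_distrib_right algebra_simps)

text \<open>A factorization \<open>a = l b u\<close> on \<open>I\<close> as required, with unit triangular \<open>l\<close> and \<open>u\<close>. The condition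
that \<open>l\<close> and \<open>u\<close> have edges only along the access relation of \<open>a\<close> is not part of the goal; it is what makes the
induction work, since it controls the supports of the solutions of the triangular systems.\<close>

definition factors_on :: "nat set \<Rightarrow> (nat \<Rightarrow> nat \<Rightarrow> real) \<Rightarrow> (nat \<Rightarrow> nat \<Rightarrow> real) \<Rightarrow>
    (nat \<Rightarrow> nat \<Rightarrow> real) \<Rightarrow> (nat \<Rightarrow> nat \<Rightarrow> real) \<Rightarrow> bool" where
  "factors_on I a l b u \<longleftrightarrow>
     (\<forall>i\<in>I. \<forall>j\<in>I. a i j = (\<Sum>k\<in>I. \<Sum>m\<in>I. l i k * b k m * u m j)) \<and>
     unit_lower_on I l \<and> unit_lower_on I (\<lambda>i j. u j i) \<and> m_matrix_on I b \<and>
     (\<forall>i\<in>I. \<forall>j\<in>I. l i j \<noteq> 0 \<or> u i j \<noteq> 0 \<longrightarrow> (i, j) \<in> (edges_on I a)\<^sup>*) \<and>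
     (\<forall>i\<in>I. \<forall>j\<in>I. b i j \<noteq> 0 \<longrightarrow> chi_on I a i j)"

lemma triangular_factorization_on:
  assumes "finite I" and "m_matrix_on I a"
  shows "\<exists>l b u. factors_on I a l b u"
  using assms
proof (induction arbitrary: a rule: finite_linorder_min_induct)
  case empty
  show ?case by (auto simp: factors_on_def unit_lower_on_def m_matrix_on_def)
next
  case (insert p I)
  note M = insert.prems and fin = insert.hyps(1)
  have p_less: "p < i" if "i \<in> I" for i using insert.hyps(2) that by blast
  then have p: "p \<notin> I" by blast
  have not_less_p: "\<not> i < p" if "i \<in> I" for i using p_less[OF that] by simp
  have ip: "a i p \<le> 0" "a p i \<le> 0" "i \<noteq> p" if "i \<in> I" for i
    using m_matrix_on_off_diagonal[OF M] that p by auto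
  let ?E = "edges_on (insert p I) a"
  show ?case
  proof (cases "a p p = 0")
    case False
    then have pos: "0 < a p p" using m_matrix_on_diagonal_nonneg[OF M, of p] fin by simp
    let ?s = "schur_complement p a"
    have acc: "(i, j) \<in> ?E\<^sup>*" if "(i, j) \<in> (edges_on I ?s)\<^sup>*" "i \<in> I" "j \<in> I" for i j
      using that schur_complement_access[OF M p pos] by simp
    obtain l b u where "factors_on I ?s l b u"
      using insert.IH[OF m_matrix_on_schur_complement[OF M p fin pos]] by blast
    then have
      fact: "\<And>i j. i \<in> I \<Longrightarrow> j \<in> I \<Longrightarrow> ?s i j = (\<Sum>k\<in>I. \<Sum>m\<in>I. l i k * b k m * u m j)"
      and l: "unit_lower_on I l" and u: "unit_lower_on I (\<lambda>i j. u j i)" and b: "m_matrix_on I b"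
      and lu: "\<And>i j. i \<in> I \<Longrightarrow> j \<in> I \<Longrightarrow> l i j \<noteq> 0 \<or> u i j \<noteq> 0 \<Longrightarrow> (i, j) \<in> (edges_on I ?s)\<^sup>*"
      and chi: "\<And>i j. i \<in> I \<Longrightarrow> j \<in> I \<Longrightarrow> b i j \<noteq> 0 \<Longrightarrow> chi_on I ?s i j"
      unfolding factors_on_def by blast+
    \<comment> \<open>One elimination step: \<open>A = [1, 0; c/d, L'] [d, 0; 0, B'] [1, r/d; 0, U']\<close> with \<open>d = a p p\<close>.\<close>
    define L where "L = (\<lambda>i j. if i = p \<or> j = p then (if j = p then a i p / a p p else 0) else l i j)"
    define U where "U = (\<lambda>i j. if i = p \<or> j = p then (if i = p then a p j / a p p else 0) else u i j)"
    define B where "B = (\<lambda>i j. if i = p \<or> j = p then (if i = j then a p p else 0) else b i j)"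
    have LI: "L i j = l i j" "U i j = u i j" "B i j = b i j" "L p j = 0" "U i p = 0"
      "B p j = 0" "B i p = 0" if "i \<in> I" "j \<in> I" for i j
      using that ip by (auto simp: L_def U_def B_def)
    have inner: "(\<Sum>k\<in>I. \<Sum>m\<in>I. L i k * B k m * U m j) =
        (if i = p \<or> j = p then 0 else a i j - a i p * a p j / a p p)"
      if "i \<in> insert p I" "j \<in> insert p I" for i j
    proof (cases "i = p \<or> j = p")
      case True
      then show ?thesis using LI by (auto intro!: sum.neutral)
    next
      case False
      then have ij: "i \<in> I" "j \<in> I" using that by auto
      have "(\<Sum>k\<in>I. \<Sum>m\<in>I. L i k * B k m * U m j) = (\<Sum>k\<in>I. \<Sum>m\<in>I. l i k * b k m * u m j)"
        using ij by (intro sum.cong refl) (simp add: LI)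
      then show ?thesis using fact[OF ij] False by (simp add: schur_complement_def)
    qed
    have "a i j = (\<Sum>k\<in>insert p I. \<Sum>m\<in>insert p I. L i k * B k m * U m j)"
      if ij: "i \<in> insert p I" "j \<in> insert p I" for i j
    proof -
      have "(\<Sum>m\<in>I. B p m * U m j) = 0" "(\<Sum>k\<in>I. L i k * B k p) = 0"
        using p by (auto simp: B_def intro!: sum.neutral)
      then show ?thesis
        unfolding sum_triple_product_insert[OF fin p] inner[OF ij]
        using pos ij by (auto simp: L_def B_def U_def)
    qed
    moreover have "unit_lower_on (insert p I) L"
      using l p p_less ip pos
      by (auto simp: unit_lower_on_def L_def divide_nonpos_pos not_less_p)
    moreover have "unit_lower_on (insert p I) (\<lambda>i j. U j i)"
      using u p p_less ip pos
      by (auto simp: unit_lower_on_def U_def divide_nonpos_pos not_less_p)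
    moreover have "m_matrix_on (insert p I) B"
    proof -
      have "m_matrix_on I B" using b m_matrix_on_cong[of I B b] LI(3) by simp
      moreover have "m_matrix_on {p} B" using pos by (intro m_matrix_on_singleton) (simp add: B_def)
      ultimately have "m_matrix_on ({p} \<union> I) B"
        by (intro m_matrix_on_block_triangular) (use fin p in \<open>auto simp: B_def\<close>)
      then show ?thesis by simp
    qed
    moreover have "(i, j) \<in> ?E\<^sup>*"
      if ij: "i \<in> insert p I" "j \<in> insert p I" and nz: "L i j \<noteq> 0 \<or> U i j \<noteq> 0" for i j
    proof (cases "i = p \<or> j = p")
      case True
      then have "i = j \<or> a i j \<noteq> 0" using nz by (auto simp: L_def U_def split: if_splits)
      then show ?thesis using ij unfolding edges_on_def by auto
    next
      case False
      then show ?thesis using acc lu[of i j] nz ij LI by auto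
    qed
    moreover have "chi_on (insert p I) a i j"
      if ij: "i \<in> insert p I" "j \<in> insert p I" and nz: "B i j \<noteq> 0" for i j
    proof (cases "i = p \<or> j = p")
      case True
      then have "i = p" "j = p" using nz by (auto simp: B_def split: if_splits)
      then show ?thesis using not_singular_max_on_first[OF p_less] pos unfolding chi_on_def by simp
    next
      case False
      then have "i \<in> I" "j \<in> I" "b i j \<noteq> 0" using ij nz by (auto simp: B_def)
      then show ?thesis
        using chi[of i j] acc singular_max_on_schur_complement[OF M p_less fin pos]
        unfolding chi_on_def by auto
    qed
    ultimately have "factors_on (insert p I) a L B U" unfolding factors_on_def by blast
    then show ?thesis by blast
  next
    case True
    have triv: "class_on (insert p I) a p = {p}"
      using class_on_zero_diagonal[OF M] fin True by simp
    have "edges_on I a \<subseteq> ?E" unfolding edges_on_def by auto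
    then have acc: "(edges_on I a)\<^sup>* \<subseteq> ?E\<^sup>*" by (rule rtrancl_mono)
    have not_mutual: False if "i \<in> I" "(i, p) \<in> ?E\<^sup>*" "(p, i) \<in> ?E\<^sup>*" for i
      using that triv p unfolding class_on_def by auto
    have sing: "singular_max_on (insert p I) a i \<longleftrightarrow> singular_max_on I a i" if "i \<in> I" for i
      using that class_on_delete_trivial_class[OF p triv that] unfolding singular_max_on_def by simp
    have sing_p: "singular_max_on (insert p I) a p"
      using triv True unfolding singular_max_on_def singular_on_def by (auto intro: exI[of _ "\<lambda>_. 1"])
    obtain l b u where "factors_on I a l b u"
      using insert.IH[of a] m_matrix_on_subset[OF M, of I] fin by blast
    then have
      fact: "\<And>i j. i \<in> I \<Longrightarrow> j \<in> I \<Longrightarrow> a i j = (\<Sum>k\<in>I. \<Sum>m\<in>I. l i k * b k m * u m j)"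
      and l: "unit_lower_on I l" and u: "unit_lower_on I (\<lambda>i j. u j i)" and b: "m_matrix_on I b"
      and lu: "\<And>i j. i \<in> I \<Longrightarrow> j \<in> I \<Longrightarrow> l i j \<noteq> 0 \<or> u i j \<noteq> 0 \<Longrightarrow> (i, j) \<in> (edges_on I a)\<^sup>*"
      and chi: "\<And>i j. i \<in> I \<Longrightarrow> j \<in> I \<Longrightarrow> b i j \<noteq> 0 \<Longrightarrow> chi_on I a i j"
      unfolding factors_on_def by blast+
    have "\<exists>x. \<forall>i\<in>I. (\<Sum>j\<in>I. l i j * x j) = a i p \<and> x i \<le> 0 \<and>
        (x i \<noteq> 0 \<longrightarrow> (\<exists>k\<in>I. a k p \<noteq> 0 \<and> (i, k) \<in> ?E\<^sup>*))"
      by (rule forward_substitution[OF fin l]) (use ip lu acc in auto)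
    then obtain x where x: "\<And>i. i \<in> I \<Longrightarrow> (\<Sum>j\<in>I. l i j * x j) = a i p" "\<And>i. i \<in> I \<Longrightarrow> x i \<le> 0"
      "\<And>i. i \<in> I \<Longrightarrow> x i \<noteq> 0 \<Longrightarrow> \<exists>k\<in>I. a k p \<noteq> 0 \<and> (i, k) \<in> ?E\<^sup>*" by blast
    have "\<exists>y. \<forall>i\<in>I. (\<Sum>j\<in>I. u j i * y j) = a p i \<and> y i \<le> 0 \<and>
        (y i \<noteq> 0 \<longrightarrow> (\<exists>k\<in>I. a p k \<noteq> 0 \<and> (i, k) \<in> (?E\<inverse>)\<^sup>*))"
      by (rule forward_substitution[OF fin u]) (use ip lu acc in \<open>auto simp: rtrancl_converse\<close>)
    then obtain y where y: "\<And>i. i \<in> I \<Longrightarrow> (\<Sum>j\<in>I. u j i * y j) = a p i" "\<And>i. i \<in> I \<Longrightarrow> y i \<le> 0"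
      "\<And>i. i \<in> I \<Longrightarrow> y i \<noteq> 0 \<Longrightarrow> \<exists>k\<in>I. a p k \<noteq> 0 \<and> (k, i) \<in> ?E\<^sup>*"
      by (auto simp: rtrancl_converse)
    have xp: "(i, p) \<in> ?E\<^sup>*" if "i \<in> I" "x i \<noteq> 0" for i
    proof -
      from x(3)[OF that] obtain k where "k \<in> I" "a k p \<noteq> 0" "(i, k) \<in> ?E\<^sup>*" by blast
      then have "(k, p) \<in> ?E" unfolding edges_on_def by auto
      then show ?thesis using \<open>(i, k) \<in> ?E\<^sup>*\<close> by simp
    qed
    have yp: "(p, i) \<in> ?E\<^sup>*" if "i \<in> I" "y i \<noteq> 0" for i
    proof -
      from y(3)[OF that] obtain k where "k \<in> I" "a p k \<noteq> 0" "(k, i) \<in> ?E\<^sup>*" by blast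
      then have "(p, k) \<in> ?E" unfolding edges_on_def by auto
      then show ?thesis using \<open>(k, i) \<in> ?E\<^sup>*\<close> by (rule converse_rtrancl_into_rtrancl)
    qed
    \<comment> \<open>Here \<open>A = [1, 0; 0, L'] [0, y; x, B'] [1, 0; 0, U']\<close>, where \<open>L' x\<close> is column \<open>p\<close> and \<open>y U'\<close> is
      row \<open>p\<close> of \<open>A\<close>.\<close>
    define L where "L = (\<lambda>i j. if i = p \<or> j = p then (if i = j then 1 else 0) else l i j)"
    define U where "U = (\<lambda>i j. if i = p \<or> j = p then (if i = j then 1 else 0) else u i j)"
    define B where "B = (\<lambda>i j. if i = p then (if j = p then 0 else y j)
                             else if j = p then x i else b i j)"
    have LI: "L i j = l i j" "U i j = u i j" "B i j = b i j" "L p j = 0" "U i p = 0" "L i p = 0" "U p j = 0"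
      "B p j = y j" "B i p = x i" if "i \<in> I" "j \<in> I" for i j
      using that ip by (auto simp: L_def U_def B_def)
    have pp: "L p p = 1" "U p p = 1" "B p p = 0" by (auto simp: L_def U_def B_def)
    have inner: "(\<Sum>k\<in>I. \<Sum>m\<in>I. L i k * B k m * U m j) = (if i = p \<or> j = p then 0 else a i j)"
      if "i \<in> insert p I" "j \<in> insert p I" for i j
    proof (cases "i = p \<or> j = p")
      case True
      then show ?thesis using LI by (auto intro!: sum.neutral)
    next
      case False
      then have ij: "i \<in> I" "j \<in> I" using that by auto
      have "(\<Sum>k\<in>I. \<Sum>m\<in>I. L i k * B k m * U m j) = (\<Sum>k\<in>I. \<Sum>m\<in>I. l i k * b k m * u m j)"
        using ij by (intro sum.cong refl) (simp add: LI)
      then show ?thesis using fact[OF ij] False by simp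
    qed
    have "a i j = (\<Sum>k\<in>insert p I. \<Sum>m\<in>insert p I. L i k * B k m * U m j)"
      if ij: "i \<in> insert p I" "j \<in> insert p I" for i j
    proof -
      have row: "(\<Sum>m\<in>I. B p m * U m j) = (if j = p then 0 else a p j)"
      proof (cases "j = p")
        case True
        then show ?thesis using LI by (auto intro!: sum.neutral)
      next
        case False
        then have j: "j \<in> I" using ij by simp
        have "(\<Sum>m\<in>I. B p m * U m j) = (\<Sum>m\<in>I. u m j * y m)"
          using j by (intro sum.cong refl) (simp add: LI)
        then show ?thesis using y(1)[OF j] False by simp
      qed
      have col: "(\<Sum>k\<in>I. L i k * B k p) = (if i = p then 0 else a i p)"
      proof (cases "i = p")
        case True
        then show ?thesis using LI by (auto intro!: sum.neutral)
      next
        case False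
        then have i: "i \<in> I" using ij by simp
        have "(\<Sum>k\<in>I. L i k * B k p) = (\<Sum>k\<in>I. l i k * x k)"
          using i by (intro sum.cong refl) (simp add: LI)
        then show ?thesis using x(1)[OF i] False by simp
      qed
      show ?thesis
        unfolding sum_triple_product_insert[OF fin p] inner[OF ij] row col
        using True ij p by (auto simp: pp LI)
    qed
    moreover have "unit_lower_on (insert p I) L"
      using l p p_less by (auto simp: unit_lower_on_def L_def not_less_p)
    moreover have "unit_lower_on (insert p I) (\<lambda>i j. U j i)"
      using u p p_less by (auto simp: unit_lower_on_def U_def not_less_p)
    moreover have "m_matrix_on (insert p I) B"
    proof -
      \<comment> \<open>Ordered as \<open>I - D\<close>, \<open>p\<close>, \<open>D\<close>, the middle factor is block lower triangular.\<close>
      define D where "D = {i\<in>I. (i, p) \<in> ?E\<^sup>*}"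
      have D: "D \<subseteq> I" "finite D" "finite (I - D)" using fin by (auto simp: D_def)
      have BI: "m_matrix_on I B" using b m_matrix_on_cong[of I B b] LI(3) by simp
      have xD: "x i = 0" if "i \<in> I - D" for i using that xp unfolding D_def by blast
      have yD: "y i = 0" if "i \<in> D" for i using that yp not_mutual unfolding D_def by blast
      have bD: "b i j = 0" if i: "i \<in> I - D" and j: "j \<in> D" for i j
      proof (rule ccontr)
        assume "b i j \<noteq> 0"
        then have "chi_on I a i j" using chi i j D by auto
        then have "(i, j) \<in> ?E\<^sup>*" using acc i j unfolding chi_on_def by auto
        then have "(i, p) \<in> ?E\<^sup>*" using j unfolding D_def by (auto intro: rtrancl_trans)
        then show False using i unfolding D_def by auto
      qed
      have "m_matrix_on ((I - D) \<union> {p}) B"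
      proof (rule m_matrix_on_block_triangular)
        show "m_matrix_on (I - D) B" using m_matrix_on_subset[OF BI fin] by blast
        show "m_matrix_on {p} B" by (rule m_matrix_on_singleton) (simp add: pp)
      qed (use D p xD y(2) LI in \<open>auto\<close>)
      then have "m_matrix_on (((I - D) \<union> {p}) \<union> D) B"
      proof (rule m_matrix_on_block_triangular)
        show "m_matrix_on D B" using m_matrix_on_subset[OF BI fin] D by blast
        show "B i j = 0" if "i \<in> I - D \<union> {p}" "j \<in> D" for i j
          using that bD yD D LI by (cases "i = p") auto
        show "B i j \<le> 0" if "i \<in> D" "j \<in> I - D \<union> {p}" for i j
        proof -
          have i: "i \<in> I" using that D by blast
          show ?thesis
          proof (cases "j = p")
            case True
            then show ?thesis using LI(9)[OF i i] x(2)[OF i] by simp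
          next
            case False
            then have "j \<in> I" "i \<noteq> j" using that by auto
            then show ?thesis using LI(3)[OF i] m_matrix_on_off_diagonal[OF b i] by simp
          qed
        qed
      qed (use D p in auto)
      moreover have "((I - D) \<union> {p}) \<union> D = insert p I" using D by auto
      ultimately show ?thesis by simp
    qed
    moreover have "(i, j) \<in> ?E\<^sup>*"
      if ij: "i \<in> insert p I" "j \<in> insert p I" and nz: "L i j \<noteq> 0 \<or> U i j \<noteq> 0" for i j
    proof (cases "i = p \<or> j = p")
      case True
      then have "i = j" using nz by (auto simp: L_def U_def split: if_splits)
      then show ?thesis by simp
    next
      case False
      then show ?thesis using acc lu[of i j] nz ij LI by auto
    qed
    moreover have "chi_on (insert p I) a i j"
      if ij: "i \<in> insert p I" "j \<in> insert p I" and nz: "B i j \<noteq> 0" for i j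
    proof -
      consider "i = p" "j \<in> I" "y j \<noteq> 0" | "i \<in> I" "j = p" "x i \<noteq> 0" | "i \<in> I" "j \<in> I" "b i j \<noteq> 0"
        using ij nz by (auto simp: B_def split: if_splits)
      then show ?thesis
      proof cases
        case 1 then show ?thesis using sing_p yp p_less unfolding chi_on_def by simp
      next
        case 2 then show ?thesis using sing_p xp p_less unfolding chi_on_def by simp
      next
        case 3 then show ?thesis using chi[of i j] acc sing unfolding chi_on_def by auto
      qed
    qed
    ultimately have "factors_on (insert p I) a L B U" unfolding factors_on_def by blast
    then show ?thesis by blast
  qed
qed

section \<open>Spectral radius, singularity and access for matrices\<close>

text \<open>A matrix as a function of its row and column index.\<close>

abbreviation (input) entries :: "'a mat \<Rightarrow> nat \<Rightarrow> nat \<Rightarrow> 'a" where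
  "entries X \<equiv> \<lambda>i j. X $$ (i, j)"

lemma index_mult_mat_sum:
  fixes A B :: "'a::semiring_0 mat"
  assumes "A \<in> carrier_mat n n" and "B \<in> carrier_mat n n" and "i < n" and "j < n"
  shows "(A * B) $$ (i, j) = (\<Sum>k\<in>{0..<n}. A $$ (i, k) * B $$ (k, j))"
  using assms by (simp add: scalar_prod_def)

lemma index_mult_mat_vec_sum:
  fixes A :: "'a::semiring_0 mat"
  assumes "A \<in> carrier_mat n n" and "v \<in> carrier_vec n" and "i < n"
  shows "(A *\<^sub>v v) $ i = (\<Sum>k\<in>{0..<n}. A $$ (i, k) * v $ k)"
  using assms by (simp add: scalar_prod_def)

text \<open>A nonnegative matrix cannot stretch a nonzero vector \<open>z \<ge> 0\<close> by a factor \<open>\<beta>\<close> beyond its spectral radius: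
after scaling by some \<open>\<gamma>\<close> strictly between the two, the powers of the matrix are bounded because the
scaled spectral radius is below 1, but along \<open>z\<close> they grow at least like \<open>(\<beta> / \<gamma>)\<close> to the power \<open>k\<close>.\<close>

lemma zero_if_growth_beyond_spectral_radius:
  fixes P :: "real mat"
  assumes n: "0 < n" and P: "P \<in> carrier_mat n n"
    and nonneg: "\<And>i j. i < n \<Longrightarrow> j < n \<Longrightarrow> 0 \<le> P $$ (i, j)"
    and radius: "spectral_radius (map_mat complex_of_real P) < \<beta>"
    and z: "\<And>i. i < n \<Longrightarrow> 0 \<le> z i"
    and growth: "\<And>i. i < n \<Longrightarrow> \<beta> * z i \<le> (\<Sum>j\<in>{0..<n}. P $$ (i, j) * z j)"
    and i: "i < n"
  shows "z i = 0"
proof -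
  let ?P = "map_mat complex_of_real P"
  let ?\<rho> = "spectral_radius ?P"
  have P': "?P \<in> carrier_mat n n" using P by simp
  have "?\<rho> \<in> norm ` spectrum ?P" by (rule spectral_radius_mem_max(1)[OF P' n])
  then have \<rho>: "0 \<le> ?\<rho>" by auto
  define \<gamma> where "\<gamma> = (?\<rho> + \<beta>) / 2"
  have \<gamma>: "?\<rho> < \<gamma>" "\<gamma> < \<beta>" "0 < \<gamma>" using radius \<rho> by (auto simp: \<gamma>_def)
  define R where "R = (1 / \<gamma>) \<cdot>\<^sub>m P"
  let ?R = "map_mat complex_of_real R"
  have R: "R \<in> carrier_mat n n" and R': "?R \<in> carrier_mat n n" using P by (auto simp: R_def)
  have R_nonneg: "0 \<le> R $$ (i, j)" if "i < n" "j < n" for i j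
    using nonneg[OF that] \<gamma>(3) P that by (simp add: R_def)
  have "spectral_radius ?R < 1"
  proof -
    have "spectral_radius ?R \<in> norm ` spectrum ?R" by (rule spectral_radius_mem_max(1)[OF R' n])
    then obtain k v where k: "spectral_radius ?R = norm k" and v: "v \<in> carrier_vec n" "v \<noteq> 0\<^sub>v n"
      "?R *\<^sub>v v = k \<cdot>\<^sub>v v"
      using R' unfolding spectrum_def eigenvalue_def eigenvector_def by auto
    have "?P = complex_of_real \<gamma> \<cdot>\<^sub>m ?R" using \<gamma>(3) P by (intro eq_matI) (auto simp: R_def)
    moreover have "(complex_of_real \<gamma> \<cdot>\<^sub>m ?R) *\<^sub>v v = complex_of_real \<gamma> \<cdot>\<^sub>v (?R *\<^sub>v v)"
      using R' v(1) by (intro eq_vecI) (auto simp: scalar_prod_def sum_distrib_left mult.assoc)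
    ultimately have "?P *\<^sub>v v = complex_of_real \<gamma> \<cdot>\<^sub>v (?R *\<^sub>v v)" by simp
    then have "?P *\<^sub>v v = (complex_of_real \<gamma> * k) \<cdot>\<^sub>v v" using v(3) by (simp add: smult_smult_assoc)
    then have "complex_of_real \<gamma> * k \<in> spectrum ?P"
      using v P' unfolding spectrum_def eigenvalue_def eigenvector_def by auto
    then have "norm (complex_of_real \<gamma> * k) \<le> ?\<rho>"
      by (intro spectral_radius_mem_max(2)[OF P' n]) blast
    then have "\<gamma> * norm k \<le> ?\<rho>" using \<gamma>(3) by (simp add: norm_mult)
    then have "\<gamma> * norm k < \<gamma> * 1" using \<gamma>(1) by simp
    then show ?thesis using \<gamma>(3) unfolding k by (simp only: mult_less_cancel_left_pos)
  qed
  then obtain c where "\<And>k. norm_bound (?R ^\<^sub>m k) c"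
    using spectral_radius_jnf_norm_bound_less_1_upper_triangular[OF R'] by blast
  then have bound: "(R ^\<^sub>m k) $$ (i, j) \<le> c" if "i < n" "j < n" for i j k
    using that R pow_carrier_mat[OF R, of k]
    unfolding of_real_hom.mat_hom_pow[OF R, symmetric] norm_bound_def by fastforce
  define r where "r = \<beta> / \<gamma>"
  have r: "1 < r" using \<gamma> by (simp add: r_def)
  have growth_R: "r * z i \<le> (\<Sum>j\<in>{0..<n}. R $$ (i, j) * z j)" if "i < n" for i
  proof -
    have "(\<Sum>j\<in>{0..<n}. R $$ (i, j) * z j) = (\<Sum>j\<in>{0..<n}. P $$ (i, j) * z j) / \<gamma>"
      unfolding sum_divide_distrib using P that by (intro sum.cong) (auto simp: R_def)
    then show ?thesis using growth[OF that] \<gamma>(3) by (simp add: r_def divide_right_mono)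
  qed
  have pow: "(\<forall>i<n. \<forall>j<n. 0 \<le> (R ^\<^sub>m k) $$ (i, j)) \<and>
      (\<forall>i<n. r ^ k * z i \<le> (\<Sum>j\<in>{0..<n}. (R ^\<^sub>m k) $$ (i, j) * z j))" for k
  proof (induction k)
    case 0
    have "(\<Sum>j\<in>{0..<n}. (1\<^sub>m n) $$ (i, j) * z j) = z i" if "i < n" for i
    proof -
      have "(\<Sum>j\<in>{0..<n}. (1\<^sub>m n) $$ (i, j) * z j) = (\<Sum>j\<in>{0..<n}. if i = j then z j else 0)"
        using that by (intro sum.cong) auto
      then show ?thesis using that by simp
    qed
    then show ?case using R by auto
  next
    case (Suc k)
    let ?Q = "R ^\<^sub>m k"
    have Q: "?Q \<in> carrier_mat n n" using R by simp
    have QR: "(R ^\<^sub>m Suc k) $$ (i, j) = (\<Sum>l\<in>{0..<n}. ?Q $$ (i, l) * R $$ (l, j))" if "i < n" "j < n" for i j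
      using index_mult_mat_sum[OF Q R that] by simp
    have "r ^ Suc k * z i \<le> (\<Sum>j\<in>{0..<n}. (R ^\<^sub>m Suc k) $$ (i, j) * z j)" if i: "i < n" for i
    proof -
      have "r ^ Suc k * z i = r * (r ^ k * z i)" by simp
      also have "\<dots> \<le> r * (\<Sum>l\<in>{0..<n}. ?Q $$ (i, l) * z l)"
        using Suc i r by (intro mult_left_mono) auto
      also have "\<dots> = (\<Sum>l\<in>{0..<n}. ?Q $$ (i, l) * (r * z l))"
        by (simp add: sum_distrib_left algebra_simps)
      also have "\<dots> \<le> (\<Sum>l\<in>{0..<n}. ?Q $$ (i, l) * (\<Sum>j\<in>{0..<n}. R $$ (l, j) * z j))"
        using Suc i growth_R by (intro sum_mono mult_left_mono) auto
      also have "\<dots> = (\<Sum>l\<in>{0..<n}. \<Sum>j\<in>{0..<n}. ?Q $$ (i, l) * R $$ (l, j) * z j)"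
        by (simp add: sum_distrib_left algebra_simps)
      also have "\<dots> = (\<Sum>j\<in>{0..<n}. \<Sum>l\<in>{0..<n}. ?Q $$ (i, l) * R $$ (l, j) * z j)"
        by (rule sum.swap)
      also have "\<dots> = (\<Sum>j\<in>{0..<n}. (R ^\<^sub>m Suc k) $$ (i, j) * z j)"
        using i by (intro sum.cong) (auto simp: QR sum_distrib_right simp del: pow_mat.simps)
      finally show ?thesis .
    qed
    moreover have "0 \<le> (R ^\<^sub>m Suc k) $$ (i, j)" if "i < n" "j < n" for i j
      unfolding QR[OF that] using Suc R_nonneg that by (intro sum_nonneg) auto
    ultimately show ?case by blast
  qed
  have le: "r ^ k * z i \<le> c * (\<Sum>j\<in>{0..<n}. z j)" for k
  proof -
    have "r ^ k * z i \<le> (\<Sum>j\<in>{0..<n}. (R ^\<^sub>m k) $$ (i, j) * z j)" using pow i by blast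
    also have "\<dots> \<le> (\<Sum>j\<in>{0..<n}. c * z j)"
      using bound z i by (intro sum_mono mult_right_mono) auto
    finally show ?thesis by (simp add: sum_distrib_left)
  qed
  show "z i = 0"
  proof (rule ccontr)
    assume "z i \<noteq> 0"
    then have zi: "0 < z i" using z[OF i] by simp
    obtain k where "c * (\<Sum>j\<in>{0..<n}. z j) / z i < r ^ k" using real_arch_pow[OF r] by blast
    then show False using le[of k] zi by (simp add: field_simps)
  qed
qed

text \<open>From left to right this is the growth bound above. Conversely, if \<open>P v = k v\<close> with \<open>norm k > \<alpha>\<close>, the
vector of absolute values of \<open>v\<close> contradicts the condition for \<open>\<alpha> I - P\<close>.\<close>

lemma m_matrix_iff_m_matrix_on:
  assumes n: "0 < n" and X: "X \<in> carrier_mat n n"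
  shows "m_matrix X \<longleftrightarrow> m_matrix_on {0..<n} (entries X)"
proof
  assume "m_matrix X"
  then obtain n' \<alpha> P where P': "P \<in> carrier_mat n' n'" "\<forall>i<n'. \<forall>j<n'. 0 \<le> P $$ (i, j)"
      "spectral_radius (map_mat complex_of_real P) \<le> \<alpha>" and X': "X = \<alpha> \<cdot>\<^sub>m 1\<^sub>m n' - P"
    unfolding m_matrix_def by blast
  have "n' = n" using X P'(1) unfolding X' by auto
  with P' X' have P: "P \<in> carrier_mat n n" "\<And>i j. i < n \<Longrightarrow> j < n \<Longrightarrow> 0 \<le> P $$ (i, j)"
    and Xe: "\<And>i j. i < n \<Longrightarrow> j < n \<Longrightarrow> X $$ (i, j) = (if i = j then \<alpha> else 0) - P $$ (i, j)"
    by auto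
  show "m_matrix_on {0..<n} (entries X)"
  proof (rule m_matrix_onI)
    fix i j assume "i \<in> {0..<n}" "j \<in> {0..<n}" "i \<noteq> j"
    then show "X $$ (i, j) \<le> 0" using Xe P by simp
  next
    fix z \<delta> i
    assume d: "(0::real) < \<delta>" and z: "\<And>i. i \<in> {0..<n} \<Longrightarrow> 0 \<le> z i"
      and le: "\<And>i. i \<in> {0..<n} \<Longrightarrow> (\<Sum>j\<in>{0..<n}. X $$ (i, j) * z j) \<le> - \<delta> * z i"
      and i: "i \<in> {0..<n}"
    show "z i = 0"
    proof (rule zero_if_growth_beyond_spectral_radius[OF n P])
      show "spectral_radius (map_mat complex_of_real P) < \<alpha> + \<delta>" using P'(3) d by simp
      fix k assume k: "k < n"
      then show "0 \<le> z k" using z by simp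
      have "(\<Sum>j\<in>{0..<n}. X $$ (k, j) * z j) =
          (\<Sum>j\<in>{0..<n}. (if k = j then \<alpha> * z j else 0) - P $$ (k, j) * z j)"
        by (rule sum.cong) (use k Xe in \<open>auto simp: left_diff_distrib\<close>)
      also have "\<dots> = \<alpha> * z k - (\<Sum>j\<in>{0..<n}. P $$ (k, j) * z j)"
        using k by (simp add: sum_subtractf)
      finally show "(\<alpha> + \<delta>) * z k \<le> (\<Sum>j\<in>{0..<n}. P $$ (k, j) * z j)"
        using le[of k] k by (simp add: algebra_simps)
    qed (use i in auto)
  qed
next
  assume M: "m_matrix_on {0..<n} (entries X)"
  \<comment> \<open>Any upper bound of the diagonal entries will do for \<open>\<alpha>\<close>.\<close>
  define \<alpha> where "\<alpha> = (\<Sum>i\<in>{0..<n}. \<bar>X $$ (i, i)\<bar>)"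
  define P where "P = \<alpha> \<cdot>\<^sub>m 1\<^sub>m n - X"
  have P: "P \<in> carrier_mat n n" unfolding P_def by (rule minus_carrier_mat[OF X])
  have Pe: "P $$ (i, j) = (if i = j then \<alpha> else 0) - X $$ (i, j)" if "i < n" "j < n" for i j
    using that X by (simp add: P_def)
  have P_nonneg: "0 \<le> P $$ (i, j)" if "i < n" "j < n" for i j
  proof (cases "i = j")
    case True
    have "\<bar>X $$ (i, i)\<bar> \<le> \<alpha>"
      unfolding \<alpha>_def by (rule member_le_sum[of i "{0..<n}" "\<lambda>i. \<bar>X $$ (i, i)\<bar>"]) (use that in auto)
    then show ?thesis using True that by (simp add: Pe)
  next
    case False
    then show ?thesis using m_matrix_on_off_diagonal[OF M] that by (simp add: Pe)
  qed
  let ?P = "map_mat complex_of_real P"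
  have P': "?P \<in> carrier_mat n n" using P by simp
  have "spectral_radius ?P \<le> \<alpha>"
  proof (rule ccontr)
    assume *: "\<not> spectral_radius ?P \<le> \<alpha>"
    have "spectral_radius ?P \<in> norm ` spectrum ?P" by (rule spectral_radius_mem_max(1)[OF P' n])
    then obtain k where k': "spectral_radius ?P = norm k" "k \<in> spectrum ?P" by auto
    then have k: "\<alpha> < norm k" using * by simp
    obtain v where v: "v \<in> carrier_vec n" "v \<noteq> 0\<^sub>v n" "?P *\<^sub>v v = k \<cdot>\<^sub>v v"
      using k'(2) P' unfolding spectrum_def eigenvalue_def eigenvector_def by auto
    let ?z = "\<lambda>i. norm (v $ i)"
    have "?z i = 0" if "i < n" for i
    proof (rule m_matrix_onD[OF M])
      show "0 < norm k - \<alpha>" using k by simp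
      fix i assume "i \<in> {0..<n}"
      then have i: "i < n" by simp
      have "norm k * ?z i = norm ((?P *\<^sub>v v) $ i)" using v i by (simp add: norm_mult)
      also have "\<dots> = norm (\<Sum>j\<in>{0..<n}. complex_of_real (P $$ (i, j)) * v $ j)"
        unfolding index_mult_mat_vec_sum[OF P' v(1) i] using P i by (auto intro!: arg_cong[of _ _ norm] sum.cong)
      also have "\<dots> \<le> (\<Sum>j\<in>{0..<n}. P $$ (i, j) * ?z j)"
        using P_nonneg i by (intro sum_norm_le) (auto simp: norm_mult)
      also have "\<dots> = (\<Sum>j\<in>{0..<n}. (if i = j then \<alpha> * ?z j else 0) - X $$ (i, j) * ?z j)"
        by (rule sum.cong) (use i Pe in \<open>auto simp: left_diff_distrib\<close>)
      also have "\<dots> = \<alpha> * ?z i - (\<Sum>j\<in>{0..<n}. X $$ (i, j) * ?z j)"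
        using i by (simp add: sum_subtractf)
      finally show "(\<Sum>j\<in>{0..<n}. X $$ (i, j) * ?z j) \<le> - (norm k - \<alpha>) * ?z i"
        by (simp add: algebra_simps)
    qed (use that in auto)
    then have "v = 0\<^sub>v n" using v(1) by (intro eq_vecI) auto
    with v(2) show False ..
  qed
  moreover have "X = \<alpha> \<cdot>\<^sub>m 1\<^sub>m n - P" using X by (intro eq_matI) (auto simp: P_def)
  ultimately show "m_matrix X" unfolding m_matrix_def using P P_nonneg by blast
qed

lemma m_matrix_transpose:
  assumes "m_matrix X"
  shows "m_matrix (transpose_mat X)"
proof -
  obtain n \<alpha> P where P: "P \<in> carrier_mat n n" "\<forall>i<n. \<forall>j<n. 0 \<le> P $$ (i, j)"
      "spectral_radius (map_mat complex_of_real P) \<le> \<alpha>" and X: "X = \<alpha> \<cdot>\<^sub>m 1\<^sub>m n - P"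
    using assms unfolding m_matrix_def by blast
  let ?P = "map_mat complex_of_real P"
  have P': "?P \<in> carrier_mat n n" and T': "transpose_mat ?P \<in> carrier_mat n n" using P by auto
  have "spectrum (transpose_mat ?P) = spectrum ?P"
    unfolding spectrum_root_char_poly[OF P'] spectrum_root_char_poly[OF T'] using P' by simp
  moreover have "map_mat complex_of_real (transpose_mat P) = transpose_mat ?P"
    by (intro eq_matI) auto
  ultimately have "spectral_radius (map_mat complex_of_real (transpose_mat P)) \<le> \<alpha>"
    using P(3) unfolding spectral_radius_def by simp
  moreover have "transpose_mat X = \<alpha> \<cdot>\<^sub>m 1\<^sub>m n - transpose_mat P"
    unfolding X using P(1) by (intro eq_matI) auto
  ultimately show ?thesis unfolding m_matrix_def using P(1,2)
    by (intro exI[of _ n] exI[of _ \<alpha>] exI[of _ "transpose_mat P"]) auto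
qed

lemma invertible_mat_iff_det:
  fixes X :: "'a::field mat"
  assumes X: "X \<in> carrier_mat n n"
  shows "invertible_mat X \<longleftrightarrow> det X \<noteq> 0"
proof
  assume "invertible_mat X"
  then obtain Y where Y: "X * Y = 1\<^sub>m n" "Y * X = 1\<^sub>m (dim_row Y)"
    using X unfolding invertible_mat_def inverts_mat_def by auto
  have "dim_col (X * Y) = n" "dim_col (Y * X) = dim_row Y" using Y by simp_all
  then have "Y \<in> carrier_mat n n" using X by auto
  then have "det X * det Y = 1" using det_mult[OF X, of Y] Y(1) by simp
  then show "det X \<noteq> 0" by auto
next
  assume "det X \<noteq> 0"
  then have "X \<in> Units (ring_mat TYPE('a) n undefined)" by (rule det_non_zero_imp_unit[OF X])
  then obtain Y where "Y \<in> carrier_mat n n" "X * Y = 1\<^sub>m n" "Y * X = 1\<^sub>m n"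
    unfolding Units_def by (auto simp: ring_mat_def)
  then show "invertible_mat X" using X unfolding invertible_mat_def inverts_mat_def by auto
qed

lemma not_invertible_submatrix_iff:
  fixes X :: "real mat"
  assumes X: "X \<in> carrier_mat n n" and S: "S \<subseteq> {0..<n}"
  shows "\<not> invertible_mat (submatrix X S S) \<longleftrightarrow> singular_on S (entries X)"
proof -
  let ?m = "card S" and ?M = "submatrix X S S"
  have fin: "finite S" using S by (rule finite_subset) simp
  have eq: "{i. i < n \<and> i \<in> S} = S" using S by auto
  have M: "?M \<in> carrier_mat ?m ?m" using X by (intro carrier_matI) (simp_all add: dim_submatrix eq)
  have Me: "?M $$ (i, j) = X $$ (pick S i, pick S j)" if "i < ?m" "j < ?m" for i j
    using that X by (simp add: submatrix_index eq)
  have inj: "inj_on (pick S) {0..<?m}"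
  proof (rule inj_onI)
    fix i j assume "i \<in> {0..<?m}" "j \<in> {0..<?m}" "pick S i = pick S j"
    then show "i = j" using pick_mono_le[of i S j] pick_mono_le[of j S i] by (metis atLeastLessThan_iff less_irrefl nat_neq_iff)
  qed
  have "pick S ` {0..<?m} \<subseteq> S" using pick_in_set_le by auto
  then have "pick S ` {0..<?m} = S"
    using card_image[OF inj] fin by (intro card_subset_eq) auto
  then have bij: "bij_betw (pick S) {0..<?m} S" using inj unfolding bij_betw_def by simp
  \<comment> \<open>\<open>q\<close> gives the position of an element of \<open>S\<close> in the increasing enumeration \<open>pick S\<close>.\<close>
  define q where "q = inv_into {0..<?m} (pick S)"
  have q: "q i < ?m" "pick S (q i) = i" if "i \<in> S" for i
    using that bij_betwE[OF bij_betw_inv_into[OF bij]] bij_betw_inv_into_right[OF bij that]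
    unfolding q_def by auto
  have q': "q (pick S i) = i" if "i < ?m" for i
    using bij_betw_inv_into_left[OF bij, of i] that unfolding q_def by simp
  have pick_S: "pick S i \<in> S" if "i < ?m" for i using that by (rule pick_in_set_le)
  have Mv: "(?M *\<^sub>v v) $ i = (\<Sum>j\<in>S. X $$ (pick S i, j) * v $ q j)"
    if "v \<in> carrier_vec ?m" "i < ?m" for v i
  proof -
    have "(?M *\<^sub>v v) $ i = (\<Sum>k\<in>{0..<?m}. X $$ (pick S i, pick S k) * v $ q (pick S k))"
      unfolding index_mult_mat_vec_sum[OF M that] using that q' Me by (intro sum.cong) auto
    also have "\<dots> = (\<Sum>j\<in>S. X $$ (pick S i, j) * v $ q j)"
      by (rule sum.reindex_bij_betw[OF bij])
    finally show ?thesis .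
  qed
  have "\<not> invertible_mat ?M \<longleftrightarrow> (\<exists>v. v \<in> carrier_vec ?m \<and> v \<noteq> 0\<^sub>v ?m \<and> ?M *\<^sub>v v = 0\<^sub>v ?m)"
    unfolding invertible_mat_iff_det[OF M] using det_0_iff_vec_prod_zero_field[OF M] by simp
  also have "\<dots> \<longleftrightarrow> singular_on S (entries X)"
  proof
    assume "\<exists>v. v \<in> carrier_vec ?m \<and> v \<noteq> 0\<^sub>v ?m \<and> ?M *\<^sub>v v = 0\<^sub>v ?m"
    then obtain v where v: "v \<in> carrier_vec ?m" "v \<noteq> 0\<^sub>v ?m" "?M *\<^sub>v v = 0\<^sub>v ?m" by blast
    have "\<exists>i<?m. v $ i \<noteq> 0"
    proof (rule ccontr)
      assume "\<not> (\<exists>i<?m. v $ i \<noteq> 0)"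
      then have "v = 0\<^sub>v ?m" using v(1) by (intro eq_vecI) auto
      with v(2) show False ..
    qed
    then obtain i where "i < ?m" "v $ i \<noteq> 0" by blast
    then have "\<exists>i\<in>S. v $ q i \<noteq> 0" using q' pick_S by (intro bexI[of _ "pick S i"]) auto
    moreover have "(\<Sum>j\<in>S. X $$ (i, j) * v $ q j) = 0" if "i \<in> S" for i
      using Mv[OF v(1) q(1)[OF that]] v(3) q[OF that] by simp
    ultimately show "singular_on S (entries X)"
      unfolding singular_on_def by (intro exI[of _ "\<lambda>i. v $ q i"]) auto
  next
    assume "singular_on S (entries X)"
    then obtain x i where x: "i \<in> S" "x i \<noteq> 0" "\<forall>i\<in>S. (\<Sum>j\<in>S. X $$ (i, j) * x j) = 0"
      unfolding singular_on_def by blast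
    define v where "v = vec ?m (\<lambda>k. x (pick S k))"
    have v: "v \<in> carrier_vec ?m" by (simp add: v_def)
    have vq: "v $ q j = x j" if "j \<in> S" for j using q[OF that] by (simp add: v_def)
    have "v \<noteq> 0\<^sub>v ?m" using vq[OF x(1)] x(2) q(1)[OF x(1)] by auto
    moreover have "?M *\<^sub>v v = 0\<^sub>v ?m"
    proof (rule eq_vecI)
      fix k assume "k < dim_vec (0\<^sub>v ?m :: real vec)"
      then have k: "k < ?m" by simp
      then show "(?M *\<^sub>v v) $ k = (0\<^sub>v ?m) $ k"
        using Mv[OF v k] x(3) pick_S[OF k] vq by simp
    qed (use M in simp)
    ultimately show "\<exists>v. v \<in> carrier_vec ?m \<and> v \<noteq> 0\<^sub>v ?m \<and> ?M *\<^sub>v v = 0\<^sub>v ?m" using v by blast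
  qed
  finally show ?thesis .
qed

lemma singular_on_transpose:
  fixes X :: "real mat"
  assumes X: "X \<in> carrier_mat n n" and S: "S \<subseteq> {0..<n}"
  shows "singular_on S (entries (transpose_mat X)) \<longleftrightarrow> singular_on S (entries X)"
proof -
  have XT: "transpose_mat X \<in> carrier_mat n n" using X by simp
  have eq: "{i. i < n \<and> i \<in> S} = S" using S by auto
  have M: "submatrix X S S \<in> carrier_mat (card S) (card S)"
    using X by (intro carrier_matI) (simp_all add: dim_submatrix eq)
  have T: "submatrix (transpose_mat X) S S = transpose_mat (submatrix X S S)"
    using X pick_in_set_le[of _ S] S
    by (intro eq_matI) (auto simp: dim_submatrix submatrix_index eq subset_iff)
  have MT: "transpose_mat (submatrix X S S) \<in> carrier_mat (card S) (card S)" using M by simp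
  have "invertible_mat (submatrix (transpose_mat X) S S) \<longleftrightarrow> invertible_mat (submatrix X S S)"
    unfolding T invertible_mat_iff_det[OF M] invertible_mat_iff_det[OF MT] det_transpose[OF M] ..
  then show ?thesis
    using not_invertible_submatrix_iff[OF X S] not_invertible_submatrix_iff[OF XT S] by blast
qed

lemma graph_of_mat_eq_edges_on:
  "X \<in> carrier_mat n n \<Longrightarrow> graph_of_mat X = edges_on {0..<n} (entries X)"
  unfolding graph_of_mat_def edges_on_def by auto

lemma has_access_iff:
  "X \<in> carrier_mat n n \<Longrightarrow> has_access X i j \<longleftrightarrow> i < n \<and> j < n \<and> (i, j) \<in> (edges_on {0..<n} (entries X))\<^sup>*"
  unfolding has_access_def by (simp add: graph_of_mat_eq_edges_on)

lemma mat_classes_eq: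
  assumes "X \<in> carrier_mat n n"
  shows "mat_classes X = class_on {0..<n} (entries X) ` {0..<n}"
  using assms unfolding mat_classes_def quotient_def class_on_def
  by (auto simp: has_access_iff)

lemma singular_maxima_iff:
  assumes X: "X \<in> carrier_mat n n"
  shows "\<mu> \<in> singular_maxima X \<longleftrightarrow> singular_max_on {0..<n} (entries X) \<mu>"
proof
  let ?C = "class_on {0..<n} (entries X)"
  assume "\<mu> \<in> singular_maxima X"
  then obtain i where i: "i < n" "\<mu> = Max (?C i)" "\<not> invertible_mat (submatrix X (?C i) (?C i))"
    unfolding singular_maxima_def singular_classes_def mat_classes_eq[OF X] by auto
  have sub: "?C i \<subseteq> {0..<n}" by (rule class_on_subset)
  have fin: "finite (?C i)" using sub by (rule finite_subset) simp
  have "i \<in> ?C i" using i by simp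
  then have \<mu>: "\<mu> \<in> ?C i" "\<forall>j\<in>?C i. j \<le> \<mu>" using i(2) Max_in[OF fin] Max_ge[OF fin] by auto
  then have "?C \<mu> = ?C i" unfolding class_on_def by (auto intro: rtrancl_trans)
  then show "singular_max_on {0..<n} (entries X) \<mu>"
    using \<mu> i(3) sub unfolding singular_max_on_def not_invertible_submatrix_iff[OF X sub] by auto
next
  let ?C = "class_on {0..<n} (entries X) \<mu>"
  assume *: "singular_max_on {0..<n} (entries X) \<mu>"
  have sub: "?C \<subseteq> {0..<n}" by (rule class_on_subset)
  have "finite ?C" using sub by (rule finite_subset) simp
  then have "Max ?C = \<mu>" using * by (intro Max_eqI) (auto simp: singular_max_on_def)
  moreover have "?C \<in> singular_classes X"
    using * not_invertible_submatrix_iff[OF X sub]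
    unfolding singular_classes_def mat_classes_eq[OF X] singular_max_on_def by auto
  ultimately show "\<mu> \<in> singular_maxima X" unfolding singular_maxima_def by force
qed

lemma chi_iff:
  assumes X: "X \<in> carrier_mat n n" and "i < n" and "j < n"
  shows "(i, j) \<in> chi X \<longleftrightarrow> chi_on {0..<n} (entries X) i j"
  using assms unfolding chi_def chi_on_def
  by (auto simp: singular_maxima_iff[OF X] has_access_iff[OF X])

section \<open>The block structure of a zero pattern\<close>

text \<open>No pair of \<open>C\<close> connects an index below \<open>t\<close> with an index from \<open>t\<close> on.\<close>

definition cut :: "nat rel \<Rightarrow> nat \<Rightarrow> bool" where
  "cut C t \<longleftrightarrow> (\<forall>(i, j)\<in>C. i < t \<longleftrightarrow> j < t)"

lemma cut_block_ends:
  assumes Q: "interval_partition n Q" and C: "within_blocks C Q" and Y: "{a..<b} \<in> Q"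
  shows "cut C a" and "cut C b"
proof -
  have part: "partition_on {0..<n} Q" using Q unfolding interval_partition_def by blast
  have "{a..<b} \<noteq> {}" using partition_onD3[OF part] Y by metis
  then have ab: "a < b" by simp
  have eq: "J = {a..<b}" if "J \<in> Q" "c \<in> J" "c \<in> {a..<b}" for J c
    using partition_onD2[OF part] that Y unfolding disjoint_def by blast
  have cross: "(x < y) = (z < y)"
    if xz: "(x, z) \<in> C" and y: "y = a \<or> b = y" for x z y
  proof -
    obtain J where J: "J \<in> Q" "x \<in> J" "z \<in> J" using C xz unfolding within_blocks_def by auto
    obtain c d where cd: "J = {c..<d}" using Q J(1) unfolding interval_partition_def by blast
    show ?thesis
    proof (rule ccontr)
      assume "(x < y) \<noteq> (z < y)"
      then have "c < y" "y < d" using J(2,3) cd by auto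
      moreover have "\<not> (c < y \<and> y < d)"
      proof
        assume *: "c < y \<and> y < d"
        then have "y - 1 \<in> J" "y \<in> J" using cd by auto
        moreover have "y \<in> {a..<b} \<longleftrightarrow> y - 1 \<notin> {a..<b}" using y ab * by auto
        ultimately show False using eq[OF J(1), of y] eq[OF J(1), of "y - 1"] by blast
      qed
      ultimately show False by blast
    qed
  qed
  show "cut C a" "cut C b" unfolding cut_def using cross by auto
qed

text \<open>The blocks of the least interval partition are the sets of indices that no cut of the pattern separates.\<close>

lemma block_structure_exists:
  assumes C: "C \<subseteq> {0..<n} \<times> {0..<n}"
  shows "\<exists>P. block_structure n C P"
proof -
  define r where "r = {(i, j). i < n \<and> j < n \<and> (\<forall>t. cut C t \<longrightarrow> (i < t \<longleftrightarrow> j < t))}"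
  have r: "equiv {0..<n} r"
    unfolding equiv_def refl_on_def sym_def trans_def r_def by auto
  define P where "P = {0..<n} // r"
  have part: "partition_on {0..<n} P" unfolding P_def by (rule partition_on_quotient[OF r])
  have interval: "\<exists>a b. J = {a..<b}" if "J \<in> P" for J
  proof -
    from \<open>J \<in> P\<close> obtain i where i: "i < n" "J = r `` {i}" unfolding P_def quotient_def by auto
    have fin: "finite J" by (rule finite_subset[of _ "{0..<n}"]) (use i in \<open>auto simp: r_def\<close>)
    have iJ: "i \<in> J" using i by (auto simp: r_def)
    have "Min J \<in> J" "Max J \<in> J" using fin iJ by (auto intro: Min_in Max_in)
    then have m: "(i, Min J) \<in> r" "(i, Max J) \<in> r" using i(2) by auto
    have "j \<in> J" if "Min J \<le> j" "j \<le> Max J" for j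
    proof -
      have "i < t \<longleftrightarrow> j < t" if "cut C t" for t
      proof
        assume "i < t"
        then have "Max J < t" using m(2) \<open>cut C t\<close> unfolding r_def by auto
        then show "j < t" using \<open>j \<le> Max J\<close> by simp
      next
        assume "j < t"
        then have "Min J < t" using \<open>Min J \<le> j\<close> by simp
        then show "i < t" using m(1) \<open>cut C t\<close> unfolding r_def by auto
      qed
      moreover have "j < n" using m(2) that unfolding r_def by auto
      ultimately show ?thesis using i unfolding r_def by auto
    qed
    then have "J = {Min J..<Suc (Max J)}" using fin by (auto simp: less_Suc_eq_le)
    then show ?thesis by blast
  qed
  have within: "within_blocks C P"
    unfolding within_blocks_def
  proof
    fix x assume x: "x \<in> C"
    then obtain i j where ij: "x = (i, j)" "i < n" "j < n" using C by auto
    then have "(i, j) \<in> r" "(i, i) \<in> r" using x unfolding r_def cut_def by auto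
    moreover have "r `` {i} \<in> P" unfolding P_def using ij by (auto intro: quotientI)
    ultimately show "x \<in> (\<Union>J\<in>P. J \<times> J)" using ij by auto
  qed
  have "refines {0..<n} P Q" if Q: "interval_partition n Q" "within_blocks C Q" for Q
    unfolding refines_def
  proof (intro conjI ballI)
    show partQ: "partition_on {0..<n} Q" using Q unfolding interval_partition_def by blast
    fix X assume "X \<in> P"
    then obtain i where i: "i < n" "X = r `` {i}" unfolding P_def quotient_def by auto
    have "i \<in> \<Union>Q" using partition_onD1[OF partQ] i(1) by auto
    then obtain Y where Y: "Y \<in> Q" "i \<in> Y" by blast
    then obtain a b where ab: "Y = {a..<b}" using Q unfolding interval_partition_def by blast
    then have "cut C a" "cut C b" using cut_block_ends[OF Q] Y(1) by auto
    then have "X \<subseteq> Y" using i Y(2) ab unfolding r_def by (auto simp: not_less[symmetric])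
    then show "\<exists>Y\<in>Q. X \<subseteq> Y" using Y(1) by blast
  qed (rule part)
  then have "block_structure n C P"
    unfolding block_structure_def interval_partition_def using part interval within by blast
  then show ?thesis ..
qed

section \<open>Access across the boundary of a block\<close>

text \<open>Let \<open>J\<close> contain a singular class, and let the rows \<open>g j\<close>, for \<open>j\<close> outside \<open>J\<close>, be nonnegative, positive
at \<open>j\<close>, and such that \<open>g j * a\<close> vanishes on \<open>J\<close>. Then \<open>J\<close> contains all indices with access to
the class.\<close>

lemma no_access_from_annihilated_rows:
  assumes M: "m_matrix_on I a" and fin: "finite I" and \<mu>: "\<mu> \<in> I"
    and sing: "singular_on (class_on I a \<mu>) a" and SJ: "class_on I a \<mu> \<subseteq> J" and J: "J \<subseteq> I"
    and g_nonneg: "\<And>j i. j \<in> I - J \<Longrightarrow> i \<in> I \<Longrightarrow> 0 \<le> g j i"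
    and g_pos: "\<And>j. j \<in> I - J \<Longrightarrow> 0 < g j j"
    and g_zero: "\<And>j k. j \<in> I - J \<Longrightarrow> k \<in> J \<Longrightarrow> (\<Sum>i\<in>I. g j i * a i k) = 0"
    and access: "(i, \<mu>) \<in> (edges_on I a)\<^sup>*"
  shows "i \<in> J"
proof -
  let ?S = "class_on I a \<mu>"
  have S: "?S \<subseteq> I" by (rule class_on_subset)
  have finS: "finite ?S" using S fin by (rule finite_subset)
  have \<mu>S: "\<mu> \<in> ?S" using \<mu> by simp
  obtain z where z: "\<And>i. i \<in> ?S \<Longrightarrow> 0 < z i" "\<And>i. i \<in> ?S \<Longrightarrow> (\<Sum>s\<in>?S. a i s * z s) = 0"
    using singular_irreducible_null_vector[OF m_matrix_on_subset[OF M fin S] finS class_on_connected sing]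
    by blast
  \<comment> \<open>Combining the columns in the class with the weights \<open>z\<close> cancels the rows in the class; the other
    rows contribute terms of one sign, which must all vanish.\<close>
  have zero_S: "g j i = 0" if j: "j \<in> I - J" and i: "i \<in> I - ?S" and s: "s \<in> ?S" "a i s \<noteq> 0" for j i s
  proof -
    let ?w = "\<lambda>i. \<Sum>s\<in>?S. a i s * z s"
    have w: "?w k \<le> 0" if "k \<in> I - ?S" for k
      using that S z(1) m_matrix_on_off_diagonal[OF M]
      by (intro sum_nonpos mult_nonpos_nonneg) (auto simp: less_imp_le)
    have "(\<Sum>k\<in>I. g j k * ?w k) = (\<Sum>s\<in>?S. (\<Sum>k\<in>I. g j k * a k s) * z s)"
      by (simp add: sum_distrib_left sum_distrib_right mult.assoc) (rule sum.swap)
    also have "\<dots> = 0" using g_zero[OF j] SJ by (intro sum.neutral) auto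
    finally have "(\<Sum>k\<in>I - ?S. g j k * ?w k) = 0"
      using sum.subset_diff[OF S fin, of "\<lambda>k. g j k * ?w k"] z(2) by simp
    then have "(\<Sum>k\<in>I - ?S. - (g j k * ?w k)) = 0" by (simp add: sum_negf)
    moreover have "0 \<le> - (g j k * ?w k)" if "k \<in> I - ?S" for k
      using mult_nonneg_nonpos[OF g_nonneg[OF j] w[OF that]] that by simp
    ultimately have "g j i * ?w i = 0"
      using sum_nonneg_eq_0_iff[of "I - ?S" "\<lambda>k. - (g j k * ?w k)"] fin i by auto
    moreover have "?w i < 0"
    proof -
      have "?w i = a i s * z s + (\<Sum>t\<in>?S - {s}. a i t * z t)" by (rule sum.remove[OF finS s(1)])
      moreover have "(\<Sum>t\<in>?S - {s}. a i t * z t) \<le> 0"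
        using i S z(1) m_matrix_on_off_diagonal[OF M]
        by (intro sum_nonpos mult_nonpos_nonneg) (auto simp: less_imp_le)
      moreover have "a i s < 0" using m_matrix_on_off_diagonal[OF M, of i s] s S i by fastforce
      then have "a i s * z s < 0" using z(1)[OF s(1)] by (simp add: mult_neg_pos)
      ultimately show ?thesis by simp
    qed
    ultimately show ?thesis by simp
  qed
  \<comment> \<open>If the diagonal term of column \<open>k\<close> vanishes, the remaining terms have one sign.\<close>
  have zero_step: "g j i = 0"
    if j: "j \<in> I - J" and k: "k \<in> J" "g j k = 0" and i: "i \<in> I" "a i k \<noteq> 0" for j k i
  proof -
    have "g j l * a l k \<le> 0" if "l \<in> I" for l
      using k J m_matrix_on_off_diagonal[OF M that, of k] g_nonneg[OF j that]
      by (cases "l = k") (auto simp: mult_nonneg_nonpos)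
    then have "\<forall>l\<in>I. - (g j l * a l k) = 0"
      using g_zero[OF j k(1)] sum_nonneg_eq_0_iff[OF fin, of "\<lambda>l. - (g j l * a l k)"]
      by (simp add: sum_negf)
    then show ?thesis using i by auto
  qed
  from access have "i \<in> J \<and> (i \<in> ?S \<or> (\<forall>j\<in>I - J. g j i = 0))"
  proof (induction rule: converse_rtrancl_induct)
    case base
    show ?case using \<mu>S SJ by blast
  next
    case (step i k)
    have ik: "i \<in> I" "a i k \<noteq> 0" using step.hyps(1) unfolding edges_on_def by auto
    show ?case
    proof (cases "i \<in> ?S")
      case True
      then show ?thesis using SJ by blast
    next
      case False
      have "g j i = 0" if "j \<in> I - J" for j
        using zero_S[OF that _ _ ik(2)] zero_step[OF that _ _ ik] ik(1) False step.IH that by blast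
      then show ?thesis using g_pos[of i] ik(1) by force
    qed
  qed
  then show ?thesis by blast
qed

lemma lower_triangular_inverse_nonneg:
  fixes L :: "real mat"
  assumes n: "0 < n" and L: "L \<in> carrier_mat n n" and inv: "invertible_mat L"
    and low: "lower_triangular L" and M: "m_matrix L"
  obtains G where "G \<in> carrier_mat n n" and "G * L = 1\<^sub>m n"
    and "\<And>i j. i < n \<Longrightarrow> j < n \<Longrightarrow> 0 \<le> G $$ (i, j)" and "\<And>i. i < n \<Longrightarrow> 0 < G $$ (i, i)"
proof -
  obtain G where G: "L * G = 1\<^sub>m n" "G * L = 1\<^sub>m (dim_row G)"
    using inv L unfolding invertible_mat_def inverts_mat_def by auto
  have "dim_col (L * G) = n" "dim_col (G * L) = dim_row G" using G by simp_all
  then have Gc: "G \<in> carrier_mat n n" using L by auto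
  have GL: "G * L = 1\<^sub>m n" using G(2) Gc by simp
  have L0: "L $$ (i, j) = 0" if "i < n" "j < n" "i < j" for i j
    using low L that unfolding lower_triangular_def by auto
  have L_on: "m_matrix_on {0..<n} (entries L)" using M m_matrix_iff_m_matrix_on[OF n L] by simp
  have diag: "0 < L $$ (i, i)" if i: "i < n" for i
  proof -
    have "det L = prod_list (diag_mat L)" by (rule det_lower_triangular[OF _ L]) (use L0 in auto)
    moreover have "det L \<noteq> 0" using inv invertible_mat_iff_det[OF L] by simp
    moreover have "L $$ (i, i) \<in> set (diag_mat L)" using i L by (auto simp: diag_mat_def)
    ultimately have "L $$ (i, i) \<noteq> 0" by (auto simp: prod_list_zero_iff)
    then show ?thesis using m_matrix_on_diagonal_nonneg[OF L_on, of i] i by auto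
  qed
  have row: "L $$ (i, i) * G $$ (i, k) = (if i = k then 1 else 0) - (\<Sum>j\<in>{0..<i}. L $$ (i, j) * G $$ (j, k))"
    if i: "i < n" and k: "k < n" for i k
  proof -
    have "(\<Sum>j\<in>{0..<n}. L $$ (i, j) * G $$ (j, k)) = (L * G) $$ (i, k)"
      by (rule index_mult_mat_sum[OF L Gc i k, symmetric])
    moreover have "(\<Sum>j\<in>{0..<n}. L $$ (i, j) * G $$ (j, k)) = (\<Sum>j\<in>{0..<Suc i}. L $$ (i, j) * G $$ (j, k))"
      by (rule sum.mono_neutral_right) (use i L0 in auto)
    ultimately show ?thesis using G(1) i k by simp
  qed
  have prev: "(\<Sum>j\<in>{0..<i}. L $$ (i, j) * G $$ (j, k)) \<le> 0"
    if "i < n" "k < n" "\<And>j. j < i \<Longrightarrow> 0 \<le> G $$ (j, k)" for i k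
    using that m_matrix_on_off_diagonal[OF L_on, of i] by (intro sum_nonpos mult_nonpos_nonneg) auto
  have nonneg: "0 \<le> G $$ (i, k)" if "i < n" "k < n" for i k
    using that(1)
  proof (induction i rule: less_induct)
    case (less i)
    then have "0 \<le> L $$ (i, i) * G $$ (i, k)"
      using row[OF less.prems that(2)] prev[OF less.prems that(2)] by fastforce
    then show ?case using diag[OF less.prems] by (simp add: zero_le_mult_iff)
  qed
  have "0 < G $$ (i, i)" if i: "i < n" for i
  proof -
    have "0 < L $$ (i, i) * G $$ (i, i)" using row[OF i i] prev[OF i i] nonneg i by fastforce
    then show ?thesis using diag[OF i] by (simp add: zero_less_mult_iff)
  qed
  then show thesis using that[OF Gc GL] nonneg by blast
qed

text \<open>The rows that annihilate columns of \<open>A\<close> are those of the inverse of \<open>L\<close>.\<close>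

lemma no_access_across_cut:
  fixes A L B U :: "real mat"
  assumes n: "0 < n" and A: "A \<in> carrier_mat n n" and MA: "m_matrix A"
    and L: "L \<in> carrier_mat n n" "invertible_mat L" "lower_triangular L" "m_matrix L"
    and B: "B \<in> carrier_mat n n" and U: "U \<in> carrier_mat n n" "upper_triangular U"
    and ALBU: "A = L * B * U" and cut: "cut (graph_of_mat B) t"
    and sing: "singular_max_on {0..<n} (entries A) \<mu>" and \<mu>t: "\<mu> < t"
    and access: "(i, \<mu>) \<in> (edges_on {0..<n} (entries A))\<^sup>*" and i: "i < n"
  shows "i < t"
proof -
  obtain G where G: "G \<in> carrier_mat n n" "G * L = 1\<^sub>m n"
    "\<And>i j. i < n \<Longrightarrow> j < n \<Longrightarrow> 0 \<le> G $$ (i, j)" "\<And>i. i < n \<Longrightarrow> 0 < G $$ (i, i)"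
    by (rule lower_triangular_inverse_nonneg[OF n L]) blast
  have "G * A = G * (L * (B * U))" unfolding ALBU using L B U by (simp add: assoc_mult_mat[of _ n n _ n _ n])
  also have "\<dots> = (G * L) * (B * U)"
    using L B U G by (intro assoc_mult_mat[symmetric, of _ n n _ n _ n]) auto
  also have "\<dots> = B * U" using G(2) B U by simp
  finally have GA: "G * A = B * U" .
  have MA': "m_matrix_on {0..<n} (entries A)" using MA m_matrix_iff_m_matrix_on[OF n A] by simp
  let ?J = "{k\<in>{0..<n}. k < t}"
  have "i \<in> ?J"
  proof (rule no_access_from_annihilated_rows[OF MA', where g = "entries G" and \<mu> = \<mu>])
    show "class_on {0..<n} (entries A) \<mu> \<subseteq> ?J"
      using sing \<mu>t class_on_subset unfolding singular_max_on_def by fastforce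
    fix j k assume j: "j \<in> {0..<n} - ?J" and k: "k \<in> ?J"
    then have jk: "j < n" "t \<le> j" "k < n" "k < t" by auto
    have "(\<Sum>i\<in>{0..<n}. G $$ (j, i) * A $$ (i, k)) = (\<Sum>m\<in>{0..<n}. B $$ (j, m) * U $$ (m, k))"
      using index_mult_mat_sum[OF G(1) A jk(1,3)] index_mult_mat_sum[OF B U(1) jk(1,3)] GA by simp
    also have "\<dots> = 0"
    proof (rule sum.neutral, rule ballI)
      fix m assume "m \<in> {0..<n}"
      then have m: "m < n" by simp
      show "B $$ (j, m) * U $$ (m, k) = 0"
      proof (cases "m < t")
        case True
        have "(j, m) \<notin> graph_of_mat B" using cut True jk unfolding cut_def by auto
        then show ?thesis using B m jk unfolding graph_of_mat_def by auto
      next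
        case False
        then have "U $$ (m, k) = 0" using U jk m by (intro upper_triangularD) auto
        then show ?thesis by simp
      qed
    qed
    finally show "(\<Sum>i\<in>{0..<n}. G $$ (j, i) * A $$ (i, k)) = 0" .
  qed (use sing access G in \<open>auto simp: singular_max_on_def\<close>)
  then show ?thesis by simp
qed

section \<open>Existence of the factorization and minimality of its block structure\<close>

lemma unit_lower_on_imp_invertible:
  assumes L: "L \<in> carrier_mat n n" and unit: "unit_lower_on {0..<n} (entries L)"
  shows "invertible_mat L"
proof -
  have "det L = prod_list (diag_mat L)"
    by (rule det_lower_triangular[OF _ L]) (use unit in \<open>auto simp: unit_lower_on_def\<close>)
  moreover have "0 \<notin> set (diag_mat L)" using unit L by (auto simp: diag_mat_def unit_lower_on_def)
  ultimately show ?thesis using invertible_mat_iff_det[OF L] by (simp add: prod_list_zero_iff)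
qed

lemma lbu_factorization_exists:
  assumes n: "0 < n" and A: "A \<in> carrier_mat n n" and M: "m_matrix A"
  shows "\<exists>L B U. L \<in> carrier_mat n n \<and> B \<in> carrier_mat n n \<and> U \<in> carrier_mat n n \<and>
      A = L * B * U \<and>
      invertible_mat L \<and> lower_triangular L \<and> m_matrix L \<and>
      invertible_mat U \<and> upper_triangular U \<and> m_matrix U \<and>
      m_matrix B \<and>
      (\<forall>j<n. \<forall>k<n. (j, k) \<notin> chi A \<longrightarrow> B $$ (j, k) = 0)"
proof -
  have "m_matrix_on {0..<n} (entries A)" using M m_matrix_iff_m_matrix_on[OF n A] by simp
  then obtain l b u where f: "factors_on {0..<n} (entries A) l b u"
    using triangular_factorization_on[of "{0..<n}"] by blast
  define L where "L = mat n n (\<lambda>(i, j). l i j)"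
  define B where "B = mat n n (\<lambda>(i, j). b i j)"
  define U where "U = mat n n (\<lambda>(i, j). u i j)"
  have car: "L \<in> carrier_mat n n" "B \<in> carrier_mat n n" "U \<in> carrier_mat n n"
    by (auto simp: L_def B_def U_def)
  have idx: "L $$ (i, j) = l i j" "B $$ (i, j) = b i j" "U $$ (i, j) = u i j" if "i < n" "j < n" for i j
    using that by (auto simp: L_def B_def U_def)
  have l: "unit_lower_on {0..<n} (entries L)" and u: "unit_lower_on {0..<n} (\<lambda>i j. U $$ (j, i))"
    using f unfolding factors_on_def unit_lower_on_def by (auto simp: idx)
  have LB: "L * B \<in> carrier_mat n n" using car by simp
  have "A = L * B * U"
  proof (rule eq_matI)
    fix i j assume "i < dim_row (L * B * U)" "j < dim_col (L * B * U)"
    then have ij: "i < n" "j < n" using car by auto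
    have "(L * B * U) $$ (i, j) = (\<Sum>m\<in>{0..<n}. (\<Sum>k\<in>{0..<n}. l i k * b k m) * u m j)"
      unfolding index_mult_mat_sum[OF LB car(3) ij]
      using ij by (intro sum.cong) (auto simp: idx index_mult_mat_sum[OF car(1,2)])
    also have "\<dots> = (\<Sum>m\<in>{0..<n}. \<Sum>k\<in>{0..<n}. l i k * b k m * u m j)"
      by (simp add: sum_distrib_right)
    also have "\<dots> = (\<Sum>k\<in>{0..<n}. \<Sum>m\<in>{0..<n}. l i k * b k m * u m j)" by (rule sum.swap)
    also have "\<dots> = A $$ (i, j)" using f ij unfolding factors_on_def by simp
    finally show "A $$ (i, j) = (L * B * U) $$ (i, j)" by simp
  qed (use A car in auto)
  moreover have "invertible_mat L" by (rule unit_lower_on_imp_invertible[OF car(1) l])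
  moreover have "lower_triangular L"
    using l car unfolding lower_triangular_def unit_lower_on_def by auto
  moreover have "m_matrix L"
    using unit_lower_on_m_matrix[OF _ l] m_matrix_iff_m_matrix_on[OF n car(1)] by simp
  moreover have "invertible_mat U"
  proof -
    have UT: "transpose_mat U \<in> carrier_mat n n" using car by simp
    have "unit_lower_on {0..<n} (entries (transpose_mat U))"
      using u car unfolding unit_lower_on_def by simp
    then have "invertible_mat (transpose_mat U)" by (rule unit_lower_on_imp_invertible[OF UT])
    then show ?thesis
      unfolding invertible_mat_iff_det[OF UT] invertible_mat_iff_det[OF car(3)] det_transpose[OF car(3)] .
  qed
  moreover have "upper_triangular U"
    using u car unfolding unit_lower_on_def by (intro upper_triangularI) auto
  moreover have "m_matrix U"
    using unit_upper_on_m_matrix[OF _ u] m_matrix_iff_m_matrix_on[OF n car(3)] by simp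
  moreover have "m_matrix B"
    using f m_matrix_on_cong[of "{0..<n}" "entries B" b] idx m_matrix_iff_m_matrix_on[OF n car(2)]
    unfolding factors_on_def by simp
  moreover have "\<forall>j<n. \<forall>k<n. (j, k) \<notin> chi A \<longrightarrow> B $$ (j, k) = 0"
  proof (intro allI impI)
    fix j k assume jk: "j < n" "k < n" "(j, k) \<notin> chi A"
    have "b j k \<noteq> 0 \<longrightarrow> chi_on {0..<n} (entries A) j k" using f jk(1,2) unfolding factors_on_def by simp
    then show "B $$ (j, k) = 0" using jk chi_iff[OF A] idx by auto
  qed
  ultimately show ?thesis using car by blast
qed

lemma singular_max_on_transpose:
  assumes A: "A \<in> carrier_mat n n"
  shows "singular_max_on {0..<n} (entries (transpose_mat A)) \<mu> \<longleftrightarrow> singular_max_on {0..<n} (entries A) \<mu>"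
    and "(edges_on {0..<n} (entries (transpose_mat A)))\<^sup>* = ((edges_on {0..<n} (entries A))\<^sup>*)\<inverse>"
proof -
  have "edges_on {0..<n} (entries (transpose_mat A)) = (edges_on {0..<n} (entries A))\<inverse>"
    using A unfolding edges_on_def by auto
  then show E: "(edges_on {0..<n} (entries (transpose_mat A)))\<^sup>* = ((edges_on {0..<n} (entries A))\<^sup>*)\<inverse>"
    by (simp add: rtrancl_converse)
  have "class_on {0..<n} (entries (transpose_mat A)) \<mu> = class_on {0..<n} (entries A) \<mu>"
    unfolding class_on_def E by auto
  then show "singular_max_on {0..<n} (entries (transpose_mat A)) \<mu> \<longleftrightarrow> singular_max_on {0..<n} (entries A) \<mu>"
    unfolding singular_max_on_def using singular_on_transpose[OF A class_on_subset] by simp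
qed

text \<open>The pairs \<open>(j, \<mu>)\<close> in \<open>chi A\<close> are confined by the factorization itself, the pairs \<open>(\<mu>, j)\<close> by the transposed one,
in which the roles of \<open>L\<close> and \<open>U\<close> are exchanged.\<close>

lemma chi_within_blocks:
  fixes A L B U :: "real mat"
  assumes n: "0 < n" and A: "A \<in> carrier_mat n n" and M: "m_matrix A"
    and L: "L \<in> carrier_mat n n" "invertible_mat L" "lower_triangular L" "m_matrix L"
    and B: "B \<in> carrier_mat n n"
    and U: "U \<in> carrier_mat n n" "invertible_mat U" "upper_triangular U" "m_matrix U"
    and ALBU: "A = L * B * U"
    and Q: "interval_partition n Q" and diag: "block_diagonal Q B"
  shows "within_blocks (chi A) Q"
  unfolding within_blocks_def
proof (rule subsetI)
  have within: "within_blocks (graph_of_mat B) Q" using diag unfolding block_diagonal_def .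
  have part: "partition_on {0..<n} Q" using Q unfolding interval_partition_def by blast
  have T: "transpose_mat A \<in> carrier_mat n n" "m_matrix (transpose_mat A)"
    using A m_matrix_transpose[OF M] by auto
  have TL: "transpose_mat L \<in> carrier_mat n n" "upper_triangular (transpose_mat L)"
    using L by (auto simp: lower_triangular_def)
  have TB: "transpose_mat B \<in> carrier_mat n n" using B by simp
  have TU: "transpose_mat U \<in> carrier_mat n n" "m_matrix (transpose_mat U)"
      "lower_triangular (transpose_mat U)"
    using U m_matrix_transpose[OF U(4)] by (auto simp: lower_triangular_def)
  have TU': "invertible_mat (transpose_mat U)"
    using U(2) invertible_mat_iff_det[OF U(1)] invertible_mat_iff_det[OF TU(1)] det_transpose[OF U(1)] by simp
  have "transpose_mat A = transpose_mat U * (transpose_mat B * transpose_mat L)"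
    unfolding ALBU using L B U by (simp add: transpose_mult[of _ n n _ n])
  then have TA: "transpose_mat A = transpose_mat U * transpose_mat B * transpose_mat L"
    using TL TB TU by (simp add: assoc_mult_mat[of _ n n _ n _ n])
  fix x assume "x \<in> chi A"
  moreover obtain i j where x: "x = (i, j)" by (cases x)
  moreover have chi_lt: "i < n" "j < n"
    using \<open>x \<in> chi A\<close> A x unfolding chi_def has_access_def by auto
  ultimately have chi: "chi_on {0..<n} (entries A) i j" using chi_iff[OF A] by simp
  define \<mu> where "\<mu> = min i j"
  have "\<mu> \<in> \<Union>Q" using partition_onD1[OF part] chi_lt by (auto simp: \<mu>_def)
  then obtain Y where Y: "Y \<in> Q" "\<mu> \<in> Y" by blast
  obtain a b where ab: "Y = {a..<b}" using Q Y(1) unfolding interval_partition_def by blast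
  have cutB: "cut (graph_of_mat B) b" using cut_block_ends(2)[OF Q within] Y(1) ab by simp
  have graphT: "graph_of_mat (transpose_mat B) = (graph_of_mat B)\<inverse>"
    unfolding graph_of_mat_def by auto
  have cutT: "cut (graph_of_mat (transpose_mat B)) b" unfolding graphT using cutB by (auto simp: cut_def)
  have \<mu>b: "\<mu> < b" using Y(2) ab by simp
  have "max i j < b"
  proof -
    let ?E = "(edges_on {0..<n} (entries A))\<^sup>*"
    consider "i = j" | "singular_max_on {0..<n} (entries A) j" "j < i" "(i, j) \<in> ?E"
      | "singular_max_on {0..<n} (entries A) i" "i < j" "(i, j) \<in> ?E"
      using chi unfolding chi_on_def by blast
    then show ?thesis
    proof cases
      case 1
      then show ?thesis using \<mu>b by (simp add: \<mu>_def)
    next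
      case 2
      have "i < b"
        by (rule no_access_across_cut[OF n A M L B U(1,3) ALBU cutB 2(1) _ 2(3)])
          (use 2 \<mu>b chi_lt in \<open>auto simp: \<mu>_def\<close>)
      then show ?thesis using 2 by simp
    next
      case 3
      have "j < b"
        by (rule no_access_across_cut[OF n T TU(1) TU' TU(3,2) TB TL TA cutT, where \<mu> = i])
          (use 3 \<mu>b chi_lt singular_max_on_transpose[OF A] in \<open>auto simp: \<mu>_def\<close>)
      then show ?thesis using 3 by simp
    qed
  qed
  then have "i \<in> Y" "j \<in> Y" using Y(2) ab by (auto simp: \<mu>_def)
  then show "x \<in> (\<Union>J\<in>Q. J \<times> J)" using Y(1) x by auto
qed

theorem theorem5p1:
  fixes A :: "real mat" and n :: nat
  assumes "0 < n" and "A \<in> carrier_mat n n" and "m_matrix A"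
  shows
    "(\<exists>L B U. L \<in> carrier_mat n n \<and> B \<in> carrier_mat n n \<and> U \<in> carrier_mat n n \<and>
        A = L * B * U \<and>
        invertible_mat L \<and> lower_triangular L \<and> m_matrix L \<and>
        invertible_mat U \<and> upper_triangular U \<and> m_matrix U \<and>
        m_matrix B \<and>
        (\<forall>j<n. \<forall>k<n. (j, k) \<notin> chi A \<longrightarrow> B $$ (j, k) = 0)) \<and>
     (\<exists>P. block_structure n (chi A) P \<and>
        (\<forall>L B U Q. L \<in> carrier_mat n n \<and> B \<in> carrier_mat n n \<and> U \<in> carrier_mat n n \<and>
           A = L * B * U \<and>
           invertible_mat L \<and> lower_triangular L \<and> m_matrix L \<and>
           invertible_mat U \<and> upper_triangular U \<and> m_matrix U \<and>
           interval_partition n Q \<and> block_diagonal Q B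
           \<longrightarrow> refines {0..<n} P Q))"
proof
  have "chi A \<subseteq> {0..<n} \<times> {0..<n}"
    using assms(2) unfolding chi_def has_access_def by auto
  then obtain P where P: "block_structure n (chi A) P" using block_structure_exists by blast
  have "refines {0..<n} P Q"
    if "L \<in> carrier_mat n n \<and> B \<in> carrier_mat n n \<and> U \<in> carrier_mat n n \<and>
        A = L * B * U \<and>
        invertible_mat L \<and> lower_triangular L \<and> m_matrix L \<and>
        invertible_mat U \<and> upper_triangular U \<and> m_matrix U \<and>
        interval_partition n Q \<and> block_diagonal Q B" for L B U Q
  proof -
    have "within_blocks (chi A) Q"
      using that by (intro chi_within_blocks[OF assms, of L B U Q]) auto
    then show ?thesis using P that unfolding block_structure_def by blast
  qed
  then show "\<exists>P. block_structure n (chi A) P \<and>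
        (\<forall>L B U Q. L \<in> carrier_mat n n \<and> B \<in> carrier_mat n n \<and> U \<in> carrier_mat n n \<and>
           A = L * B * U \<and>
           invertible_mat L \<and> lower_triangular L \<and> m_matrix L \<and>
           invertible_mat U \<and> upper_triangular U \<and> m_matrix U \<and>
           interval_partition n Q \<and> block_diagonal Q B
           \<longrightarrow> refines {0..<n} P Q)"
    using P by blast
qed (rule lbu_factorization_exists[OF assms])

end
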